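(* Let $\mathcal{X}\subseteq\mathbb{R}^{d_x}$, $\mathcal{Y}\subseteq\mathbb{R}^{d_y}$, let $\mathcal{P}$ be a probability distribution on $\mathcal{X}\times\mathcal{Y}$, let $f(\cdot\,;\theta):\mathbb{R}^{d_x}\to\mathbb{R}^{d_y}$ be a prediction model with parameter $\theta\in\mathbb{R}^{d_\theta}$, and let $\ell:\mathbb{R}^{d_y}\times\mathcal{Y}\to\mathbb{R}_{\ge 0}$ be a loss function. Let $n,s,q$ be integers with $1\le q\le s\le n$, and for $i=1,\dots,n$ let $g_i^x:\mathcal{X}\to\mathcal{X}$ and $g_i^y:\mathcal{Y}\to\mathcal{Y}$ be arbitrary fixed (corruption) functions; for a dataset $\mathcal{D}=((x_i,y_i))_{i=1}^n$ write $g(\mathcal{D})=((g_i^x(x_i),g_i^y(y_i)))_{i=1}^n$. Let $\Theta$ be a fixed (nonempty) subset of $\mathbb{R}^{d_\theta}$, and let $M<\infty$ be the least upper bound such that $|\ell(f(x;\theta),y)-\ell(f(x';\theta),y')|\le M$ for all $\theta\in\Theta$ and all $(x,y),(x',y')\in\mathcal{X}\times\mathcal{Y}$. Then, for any $\delta>0$, with probability at least $1-\delta$ over an i.i.d. draw of $n$ examples $\mathcal{D}=((x_i,y_i))_{i=1}^n$ from $\mathcal{P}$, the following holds for all $\theta\in\Theta$: $$\mathbb{E}_{(x,y)\sim\mathcal{P}}[\ell(f(x;\theta),y)]\le L_q(\theta;g(\mathcal{D}))+2\hat{\mathfrak{R}}_n(\Theta)+M\left(2+\frac{s}{q}\right)\sqrt{\frac{\ln(2/\delta)}{2n}}-\mathcal{Q}_{n,q}(\Theta,g),$$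 where $$\mathcal{Q}_{n,q}(\Theta,g):=\mathbb{E}_{\bar{\mathcal{D}}}\left[\inf_{\theta\in\Theta}\frac{1}{n}\sum_{i=1}^n\left(\frac{r_i(\theta;g(\bar{\mathcal{D}}))\,n}{q}\,\ell\big(f(g_i^x(\bar x_i);\theta),g_i^y(\bar y_i)\big)-\ell(f(\bar x_i;\theta),\bar y_i)\right)\right],$$ with $\bar{\mathcal{D}}=((\bar x_i,\bar y_i))_{i=1}^n$ an i.i.d. sample of size $n$ from $\mathcal{P}$.
   Context: For a dataset $\mathcal{D}=((x_i,y_i))_{i=1}^n$ in $\mathcal{X}\times\mathcal{Y}$ (possibly a corrupted one such as $g(\mathcal{D})$) and $\theta\in\mathbb{R}^{d_\theta}$: - Individual losses: $L_i(\theta;\mathcal{D}):=\ell(f(x_i;\theta),y_i)$. - Ordered indexes: $(1),\dots,(n)$ is the permutation of $\{1,\dots,n\}$, depending on $(\theta,\mathcal{D})$, such that $L_{(1)}(\theta;\mathcal{D})\ge L_{(2)}(\theta;\mathcal{D})\ge\cdots\ge L_{(n)}(\theta;\mathcal{D})$; ties are broken by an arbitrary fixed rule so that the order is unique. - Weights: with $s$ the mini-batch size and $q$ the number of top-loss samples used from each mini-batch, $$\gamma_j:=\frac{\sum_{l=0}^{q-1}\binom{j-1}{l}\binom{n-j}{s-l-1}}{\binom{n}{s}},\qquad j=1,\dots,n,$$ where $\binom{a}{b}=0$ if $b>a$ or $b<0$. Equivalently, $\gamma_j$ is the probability that $j$ is among the $q$ smallest elements of a uniformly random $s$-element subset of $\{1,\dots,n\}$.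 - Top-$q$-biased objective: $L_q(\theta;\mathcal{D}):=\frac{1}{q}\sum_{j=1}^n\gamma_j L_{(j)}(\theta;\mathcal{D})$. - $r_i(\theta;\mathcal{D}):=\sum_{j=1}^n\mathbf{1}\{i=(j)\}\,\gamma_j$, where $(j)$ is the ordered index determined by $(\theta,\mathcal{D})$; i.e. $r_i$ is the weight $\gamma_j$ of the rank $j$ of sample $i$. - Empirical Rademacher complexity (on the uncorrupted drawn sample $\mathcal{D}$): $\hat{\mathfrak{R}}_n(\Theta):=\mathbb{E}_{\xi}\left[\sup_{\theta\in\Theta}\frac{1}{n}\sum_{i=1}^n\xi_i\,\ell(f(x_i;\theta),y_i)\right]$, where $\xi_1,\dots,\xi_n$ are independent and uniform on $\{-1,1\}$. All functions, and the suprema and infima over $\Theta$ that appear, are assumed measurable so that the expectations and probabilities are well defined. *)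

theory Defs
  imports "HOL-Probability.Probability"
begin

text \<open>
  A dataset of size \<open>n\<close> is a function on \<open>nat\<close> of which only the values at \<open>{1..n}\<close> matter; it is
  drawn i.i.d. from \<open>P\<close> when it is distributed according to \<open>PiM {1..n} (\<lambda>_. P)\<close>.
\<close>

definition indiv_loss ::
  "('y \<Rightarrow> 'y \<Rightarrow> real) \<Rightarrow> ('x \<Rightarrow> 't \<Rightarrow> 'y) \<Rightarrow> 't \<Rightarrow> (nat \<Rightarrow> 'x \<times> 'y) \<Rightarrow> nat \<Rightarrow> real"
where
  "indiv_loss loss f \<theta> D i = loss (f (fst (D i)) \<theta>) (snd (D i))"

definition corrupt ::
  "(nat \<Rightarrow> 'x \<Rightarrow> 'x) \<Rightarrow> (nat \<Rightarrow> 'y \<Rightarrow> 'y) \<Rightarrow> (nat \<Rightarrow> 'x \<times> 'y) \<Rightarrow> (nat \<Rightarrow> 'x \<times> 'y)"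
where
  "corrupt gx gy D = (\<lambda>i. (gx i (fst (D i)), gy i (snd (D i))))"

text \<open>
  \<open>ord \<theta> D j\<close> is the index of the sample of rank \<open>j\<close>. The arbitrary fixed tie-breaking rule is
  modelled by letting \<open>ord\<close> be any function that selects, for each \<open>\<theta>\<close> and \<open>D\<close>, one permutation
  sorting the individual losses in decreasing order.
\<close>

definition ordered_indexes ::
  "('y \<Rightarrow> 'y \<Rightarrow> real) \<Rightarrow> ('x \<Rightarrow> 't \<Rightarrow> 'y) \<Rightarrow> nat \<Rightarrow>
   ('t \<Rightarrow> (nat \<Rightarrow> 'x \<times> 'y) \<Rightarrow> nat \<Rightarrow> nat) \<Rightarrow> bool"
where
  "ordered_indexes loss f n ord \<longleftrightarrow>
     (\<forall>\<theta> D. ord \<theta> D permutes {1..n} \<and>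
        (\<forall>j k. 1 \<le> j \<and> j \<le> k \<and> k \<le> n \<longrightarrow>
           indiv_loss loss f \<theta> D (ord \<theta> D j) \<ge> indiv_loss loss f \<theta> D (ord \<theta> D k)))"

text \<open>No subtraction below truncates when \<open>1 \<le> j \<le> n\<close> and \<open>q \<le> s\<close>.\<close>

definition rank_weight :: "nat \<Rightarrow> nat \<Rightarrow> nat \<Rightarrow> nat \<Rightarrow> real" where
  "rank_weight n s q j =
     (\<Sum>l<q. real ((j - 1) choose l) * real ((n - j) choose (s - l - 1))) / real (n choose s)"

definition top_q_objective ::
  "('y \<Rightarrow> 'y \<Rightarrow> real) \<Rightarrow> ('x \<Rightarrow> 't \<Rightarrow> 'y) \<Rightarrow> ('t \<Rightarrow> (nat \<Rightarrow> 'x \<times> 'y) \<Rightarrow> nat \<Rightarrow> nat) \<Rightarrow>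
   nat \<Rightarrow> nat \<Rightarrow> nat \<Rightarrow> 't \<Rightarrow> (nat \<Rightarrow> 'x \<times> 'y) \<Rightarrow> real"
where
  "top_q_objective loss f ord n s q \<theta> D =
     (1 / real q) * (\<Sum>j=1..n. rank_weight n s q j * indiv_loss loss f \<theta> D (ord \<theta> D j))"

definition sample_weight ::
  "('t \<Rightarrow> (nat \<Rightarrow> 'x \<times> 'y) \<Rightarrow> nat \<Rightarrow> nat) \<Rightarrow>
   nat \<Rightarrow> nat \<Rightarrow> nat \<Rightarrow> 't \<Rightarrow> (nat \<Rightarrow> 'x \<times> 'y) \<Rightarrow> nat \<Rightarrow> real"
where
  "sample_weight ord n s q \<theta> D i =
     (\<Sum>j=1..n. (if i = ord \<theta> D j then 1 else 0) * rank_weight n s q j)"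

definition population_risk ::
  "('y \<Rightarrow> 'y \<Rightarrow> real) \<Rightarrow> ('x \<Rightarrow> 't \<Rightarrow> 'y) \<Rightarrow> ('x \<times> 'y) measure \<Rightarrow> 't \<Rightarrow> real"
where
  "population_risk loss f P \<theta> = (\<integral>z. loss (f (fst z) \<theta>) (snd z) \<partial>P)"

text \<open>
  The supremum over \<open>\<Theta>\<close> can be \<open>\<infinity>\<close> (it is not \<open>-\<infinity>\<close> for nonempty \<open>\<Theta>\<close>), hence the extended reals.
  The expectation over the \<open>n\<close> independent uniform signs is the average over the \<open>2 ^ n\<close> sign vectors;
  see \<open>emp_rademacher_eq_expectation\<close> below.
\<close>

definition rademacher_sup ::
  "('y \<Rightarrow> 'y \<Rightarrow> real) \<Rightarrow> ('x \<Rightarrow> 't \<Rightarrow> 'y) \<Rightarrow> nat \<Rightarrow> 't set \<Rightarrow> (nat \<Rightarrow> 'x \<times> 'y) \<Rightarrow>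
   (nat \<Rightarrow> real) \<Rightarrow> ereal"
where
  "rademacher_sup loss f n \<Theta> D \<xi> =
     (SUP \<theta>\<in>\<Theta>. ereal ((1 / real n) * (\<Sum>i=1..n. \<xi> i * indiv_loss loss f \<theta> D i)))"

definition emp_rademacher ::
  "('y \<Rightarrow> 'y \<Rightarrow> real) \<Rightarrow> ('x \<Rightarrow> 't \<Rightarrow> 'y) \<Rightarrow> nat \<Rightarrow> 't set \<Rightarrow> (nat \<Rightarrow> 'x \<times> 'y) \<Rightarrow> ereal"
where
  "emp_rademacher loss f n \<Theta> D =
     (\<Sum>\<xi>\<in>{1..n} \<rightarrow>\<^sub>E {-1, 1}. rademacher_sup loss f n \<Theta> D \<xi>) / 2 ^ n"

lemma emp_rademacher_eq_expectation:
  assumes fin: "\<And>\<xi>. \<xi> \<in> {1..n} \<rightarrow>\<^sub>E {-1, 1} \<Longrightarrow> \<bar>rademacher_sup loss f n \<Theta> D \<xi>\<bar> \<noteq> \<infinity>"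
  shows "emp_rademacher loss f n \<Theta> D =
    ereal (measure_pmf.expectation (Pi_pmf {1..n} undefined (\<lambda>_. pmf_of_set {-1, 1}))
      (\<lambda>\<xi>. real_of_ereal (rademacher_sup loss f n \<Theta> D \<xi>)))"
proof -
  let ?S = "{1..n} \<rightarrow>\<^sub>E {-1, 1 :: real}"
  let ?r = "\<lambda>\<xi>. real_of_ereal (rademacher_sup loss f n \<Theta> D \<xi>)"
  have card: "card ?S = 2 ^ n" by (simp add: card_PiE numeral_2_eq_2)
  have S: "finite ?S" "?S \<noteq> {}" by (auto simp: PiE_eq_empty_iff intro!: finite_PiE)
  have dflt: "PiE_dflt {1..n} undefined (\<lambda>_. {-1, 1 :: real}) = ?S"
    by (auto simp: PiE_dflt_def PiE_def extensional_def)
  have "Pi_pmf {1..n} undefined (\<lambda>_. pmf_of_set {-1, 1 :: real}) = pmf_of_set ?S"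
    unfolding dflt[symmetric] by (rule Pi_pmf_of_set) auto
  then have "measure_pmf.expectation (Pi_pmf {1..n} undefined (\<lambda>_. pmf_of_set {-1, 1})) ?r
      = (\<Sum>\<xi>\<in>?S. ?r \<xi>) / 2 ^ n"
    using S by (simp add: integral_pmf_of_set card del: One_nat_def)
  moreover have "(\<Sum>\<xi>\<in>?S. rademacher_sup loss f n \<Theta> D \<xi>) = ereal (\<Sum>\<xi>\<in>?S. ?r \<xi>)"
    unfolding sum_ereal[symmetric] using fin by (intro sum.cong) (auto simp: ereal_real)
  moreover have "(2 :: ereal) ^ n = ereal (2 ^ n)"
    by (metis ereal_power numeral_eq_ereal)
  ultimately show ?thesis
    by (simp add: emp_rademacher_def del: One_nat_def)
qed

definition corruption_inf ::
  "('y \<Rightarrow> 'y \<Rightarrow> real) \<Rightarrow> ('x \<Rightarrow> 't \<Rightarrow> 'y) \<Rightarrow> ('t \<Rightarrow> (nat \<Rightarrow> 'x \<times> 'y) \<Rightarrow> nat \<Rightarrow> nat) \<Rightarrow>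
   nat \<Rightarrow> nat \<Rightarrow> nat \<Rightarrow> 't set \<Rightarrow> (nat \<Rightarrow> 'x \<Rightarrow> 'x) \<Rightarrow> (nat \<Rightarrow> 'y \<Rightarrow> 'y) \<Rightarrow> (nat \<Rightarrow> 'x \<times> 'y) \<Rightarrow> real"
where
  "corruption_inf loss f ord n s q \<Theta> gx gy D =
     (INF \<theta>\<in>\<Theta>. (1 / real n) * (\<Sum>i=1..n.
        sample_weight ord n s q \<theta> (corrupt gx gy D) i * real n / real q
          * indiv_loss loss f \<theta> (corrupt gx gy D) i
        - indiv_loss loss f \<theta> D i))"

definition Q_term ::
  "('y \<Rightarrow> 'y \<Rightarrow> real) \<Rightarrow> ('x \<Rightarrow> 't \<Rightarrow> 'y) \<Rightarrow> ('t \<Rightarrow> (nat \<Rightarrow> 'x \<times> 'y) \<Rightarrow> nat \<Rightarrow> nat) \<Rightarrow>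
   ('x \<times> 'y) measure \<Rightarrow> nat \<Rightarrow> nat \<Rightarrow> nat \<Rightarrow> 't set \<Rightarrow> (nat \<Rightarrow> 'x \<Rightarrow> 'x) \<Rightarrow> (nat \<Rightarrow> 'y \<Rightarrow> 'y) \<Rightarrow> real"
where
  "Q_term loss f ord P n s q \<Theta> gx gy =
     (\<integral>D. corruption_inf loss f ord n s q \<Theta> gx gy D \<partial>(\<Pi>\<^sub>M i\<in>{1..n}. P))"

end

theory Submission
  imports Defs
begin

text \<open>
  If the losses are unbounded over \<open>\<Theta>\<close>, the empirical Rademacher complexity is \<open>\<infinity>\<close> because the
  oscillation of each loss is at most \<open>M\<close>, and the bound is trivial. Otherwise McDiarmid's inequality
  applies to the gap \<open>sup\<^sub>\<theta> (R(\<theta>) - L\<^sub>q(\<theta>; g(D)))\<close> and to the empirical Rademacher complexity.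
  Replacing one sample moves each order statistic of the losses in the same direction and their sum
  by at most \<open>M\<close>; since every rank weight is at most \<open>s/n\<close>, the gap has differences at most
  \<open>M s / (n q)\<close>. Subtracting and adding the plain empirical risk bounds the expected gap by a
  symmetrization term minus \<open>Q\<close>.
\<close>

subsection \<open>McDiarmid's inequality\<close>

text \<open>The factor 2 + s/q collects two one-sided deviations, each taken at level \<delta>/2:
  differences M s/(n q) over n samples give s/q for the gap, and differences M/n give 1 for the
  empirical Rademacher complexity, which enters doubled because symmetrization costs a factor 2.
  Concentrating the gap to L_q itself, rather than to the plain empirical risk, lets Q stay an
  expectation: it is split off from the mean of the gap, and its own fluctuation is never paid for.
  Measurability shapes the rest. It is assumed for the gap, for the infimum in Q and for the signed
  supremum at each fixed sign vector, but not for the supremum of risk minus empirical risk. That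
  supremum therefore never appears: symmetrization bounds the difference at each \<theta> by one
  integrable majorant, built for a single sign vector, and the average over sign vectors is taken
  only after integration.\<close>

definition bounded_differences ::
  "('i \<Rightarrow> 'a measure) \<Rightarrow> 'i set \<Rightarrow> (('i \<Rightarrow> 'a) \<Rightarrow> real) \<Rightarrow> ('i \<Rightarrow> real) \<Rightarrow> bool"
where
  "bounded_differences M I f c \<longleftrightarrow>
     (\<forall>i\<in>I. \<forall>x\<in>space (PiM I M). \<forall>y\<in>space (M i). \<bar>f (x(i := y)) - f x\<bar> \<le> c i)"

lemma bounded_differencesD:
  assumes "bounded_differences M I f c" "i \<in> I" "x \<in> space (PiM I M)" "y \<in> space (M i)"
  shows "\<bar>f (x(i := y)) - f x\<bar> \<le> c i"
  using assms by (auto simp: bounded_differences_def)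

lemma space_PiM_fun_upd:
  assumes "x \<in> space (PiM I M)" "i \<in> I" "y \<in> space (M i)"
  shows "x(i := y) \<in> space (PiM I M)"
  using assms by (auto simp: space_PiM PiE_iff extensional_def)

text \<open>\<open>override_on x y J\<close> follows \<open>y\<close> on \<open>J\<close> and
  \<open>x\<close> elsewhere, so enlarging \<open>J\<close> by one index is one coordinate
  replacement. Both points are extensional, hence \<open>J = I\<close> ends exactly at
  \<open>y\<close>. With a base point this makes \<open>f\<close> bounded, so integrability comes
  from bounded differences and measurability alone.\<close>

lemma bounded_differences_dist:
  assumes fin: "finite I" and bd: "bounded_differences M I f c"
    and x: "x \<in> space (PiM I M)" and y: "y \<in> space (PiM I M)"
  shows "\<bar>f x - f y\<bar> \<le> (\<Sum>i\<in>I. c i)"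
proof -
  have *: "\<bar>f (override_on x y J) - f x\<bar> \<le> (\<Sum>i\<in>J. c i)
      \<and> override_on x y J \<in> space (PiM I M)" if "J \<subseteq> I" for J
    using finite_subset[OF that fin] that
  proof (induction J rule: finite_induct)
    case empty
    then show ?case using x by simp
  next
    case (insert j J)
    have upd: "override_on x y (insert j J) = (override_on x y J)(j := y j)"
      by (auto simp: override_on_def)
    have yj: "y j \<in> space (M j)"
      using y insert.prems by (auto simp: space_PiM)
    have IH: "\<bar>f (override_on x y J) - f x\<bar> \<le> (\<Sum>i\<in>J. c i)"
        "override_on x y J \<in> space (PiM I M)"
      using insert by auto
    have "\<bar>f ((override_on x y J)(j := y j)) - f (override_on x y J)\<bar> \<le> c j"
      using insert.prems yj IH by (intro bounded_differencesD[OF bd]) auto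
    moreover have "(override_on x y J)(j := y j) \<in> space (PiM I M)"
      using insert.prems yj IH by (intro space_PiM_fun_upd) auto
    moreover have "(\<Sum>i\<in>insert j J. c i) = c j + (\<Sum>i\<in>J. c i)"
      using insert.hyps by simp
    ultimately show ?case
      unfolding upd using IH(1) by linarith
  qed
  have "override_on x y I = y"
    using x y by (auto simp: space_PiM PiE_iff extensional_def override_on_def)
  then show ?thesis
    using *[of I] by auto
qed

lemma bounded_differences_bounded:
  assumes "finite I" "bounded_differences M I f c"
  shows "\<exists>B. \<forall>x\<in>space (PiM I M). \<bar>f x\<bar> \<le> B"
proof (cases "space (PiM I M) = {}")
  case False
  then obtain x0 where x0: "x0 \<in> space (PiM I M)" by blast
  show ?thesis
    using bounded_differences_dist[OF assms _ x0]
    by (intro exI[of _ "\<bar>f x0\<bar> + (\<Sum>i\<in>I. c i)"]) fastforce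
qed blast

lemma integrable_bounded_differences:
  assumes M: "\<And>i. prob_space (M i)" and "finite I" "bounded_differences M I f c"
    and "f \<in> borel_measurable (PiM I M)"
  shows "integrable (PiM I M) f"
proof -
  interpret prob_space "PiM I M" by (intro prob_space_PiM M)
  obtain B where "\<forall>x\<in>space (PiM I M). \<bar>f x\<bar> \<le> B"
    using bounded_differences_bounded[OF assms(2,3)] by blast
  then show ?thesis
    using assms(4) by (intro integrable_const_bound[where B = B]) auto
qed

text \<open>Hoeffding's lemma asks for an interval containing the values, while bounded differences
  control only the oscillation. Anchoring the interval at the infimum gives length \<open>c\<close>;
  an interval centred at some value would have length \<open>2 * c\<close> and cost a factor 4 in
  the exponent.\<close>

lemma (in prob_space) nn_integral_exp_bounded_range:
  fixes f :: "'a \<Rightarrow> real"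
  assumes f [measurable]: "f \<in> borel_measurable M" and l: "l > 0"
    and range: "\<And>x y. x \<in> space M \<Longrightarrow> y \<in> space M \<Longrightarrow> \<bar>f x - f y\<bar> \<le> c"
  shows "(\<integral>\<^sup>+x. exp (l * (f x - expectation f)) \<partial>M) \<le> ennreal (exp (l\<^sup>2 * c\<^sup>2 / 8))"
proof -
  obtain x0 where x0: "x0 \<in> space M" using not_empty by auto
  have bdd: "bdd_below (f ` space M)"
    using range[OF x0] by (intro bdd_belowI2[of _ "f x0 - c"]) (auto simp: abs_le_iff algebra_simps)
  define a where "a = (INF x\<in>space M. f x)"
  have lo: "a \<le> f x" if "x \<in> space M" for x
    unfolding a_def using that by (intro cINF_lower bdd) auto
  have hi: "f x \<le> a + c" if "x \<in> space M" for x
  proof -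
    have "f x - c \<le> a"
      unfolding a_def using range[OF that] not_empty by (intro cINF_greatest) (auto simp: abs_le_iff algebra_simps)
    then show ?thesis by simp
  qed
  interpret interval_bounded_random_variable M f a "a + c"
    by unfold_locales (auto intro!: AE_I2 lo hi)
  show ?thesis
    using Hoeffdings_lemma_nn_integral[OF l] by simp
qed

text \<open>Induction over the coordinates takes the place of a Doob martingale. Averaging out
  coordinate \<open>i\<close> leaves \<open>W\<close>, to which the induction hypothesis applies;
  with the other coordinates fixed, f - W is centred with oscillation \<open>c i\<close>, and
  Hoeffding's lemma contributes one factor. Nonnegative integrals avoid any discussion of integrable
  exponentials.\<close>

lemma mcdiarmid_mgf:
  fixes f :: "('i \<Rightarrow> 'a) \<Rightarrow> real"
  assumes M: "\<And>i. prob_space (M i)" and "finite I"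
    and "f \<in> borel_measurable (PiM I M)" and "bounded_differences M I f c" and l: "l > 0"
  shows "(\<integral>\<^sup>+x. exp (l * (f x - integral\<^sup>L (PiM I M) f)) \<partial>PiM I M)
    \<le> ennreal (exp (l\<^sup>2 * (\<Sum>i\<in>I. (c i)\<^sup>2) / 8))"
  using assms(2-4)
proof (induction I arbitrary: f rule: finite_induct)
  case empty
  interpret product_sigma_finite M
    by (intro product_sigma_finite.intro prob_space_imp_sigma_finite M)
  show ?case
    by (simp add: PiM_empty nn_integral_count_space_finite lebesgue_integral_count_space_finite)
next
  case (insert i I)
  interpret product_prob_space M I
    by (intro product_prob_space.intro product_prob_space_axioms.intro product_sigma_finite.intro
        prob_space_imp_sigma_finite M)
  note f [measurable] = insert.prems(1)
  have [simp]: "finite I" "i \<notin> I" by fact+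
  define W where "W x = (\<integral>y. f (x(i := y)) \<partial>M i)" for x
  have W [measurable]: "W \<in> borel_measurable (PiM I M)"
    unfolding W_def by measurable
  have upd: "x(i := y) \<in> space (PiM (insert i I) M)" if "x \<in> space (PiM I M)" "y \<in> space (M i)" for x y
    using that by (auto simp: space_PiM PiE_iff extensional_def)
  have slice [measurable]: "(\<lambda>y. f (x(i := y))) \<in> borel_measurable (M i)" if "x \<in> space (PiM I M)" for x
    using that by measurable
  obtain B where B: "\<And>x. x \<in> space (PiM (insert i I) M) \<Longrightarrow> \<bar>f x\<bar> \<le> B"
    using bounded_differences_bounded[OF _ insert.prems(2)] by auto
  have slice_int: "integrable (M i) (\<lambda>y. f (x(i := y)))" if "x \<in> space (PiM I M)" for x
    using that B upd by (intro M.integrable_const_bound[where B = B]) auto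
  \<comment> \<open>Updates at \<open>j\<close> and at \<open>i\<close> commute, so averaging over
    coordinate \<open>i\<close> preserves the constants of all other coordinates.\<close>
  have W_bd: "bounded_differences M I W c"
    unfolding bounded_differences_def
  proof safe
    fix j x z assume j: "j \<in> I" and x: "x \<in> space (PiM I M)" and z: "z \<in> space (M j)"
    have x': "x(j := z) \<in> space (PiM I M)" using space_PiM_fun_upd[OF x j z] .
    have "W (x(j := z)) - W x = (\<integral>y. f ((x(j := z))(i := y)) - f (x(i := y)) \<partial>M i)"
      unfolding W_def by (rule Bochner_Integration.integral_diff[symmetric]) (intro slice_int x x')+
    also have "\<bar>\<dots>\<bar> \<le> (\<integral>y. \<bar>f ((x(j := z))(i := y)) - f (x(i := y))\<bar> \<partial>M i)"
      by (rule integral_abs_bound)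
    also have "\<dots> \<le> (\<integral>y. c j \<partial>M i)"
    proof (rule integral_mono)
      fix y assume y: "y \<in> space (M i)"
      have "(x(j := z))(i := y) = (x(i := y))(j := z)"
        using j by (intro fun_upd_twist) auto
      then show "\<bar>f ((x(j := z))(i := y)) - f (x(i := y))\<bar> \<le> c j"
        using bounded_differencesD[OF insert.prems(2) insertI2[OF j] upd[OF x y] z] by (simp only:)
    qed (use x x' slice_int in auto)
    also have "\<dots> = c j" by (simp add: M.prob_space)
    finally show "\<bar>W (x(j := z)) - W x\<bar> \<le> c j" .
  qed
  \<comment> \<open>By Fubini \<open>f\<close> and \<open>W\<close> have the same mean, so the one
    constant \<open>e\<close> centres both.\<close>
  have EW: "integral\<^sup>L (PiM (insert i I) M) f = integral\<^sup>L (PiM I M) W"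
    unfolding W_def using insert.prems
    by (intro product_integral_insert integrable_bounded_differences[OF M]) auto
  define e where "e = integral\<^sup>L (PiM I M) W"
  have "(\<integral>\<^sup>+x. exp (l * (f x - e)) \<partial>PiM (insert i I) M)
      = (\<integral>\<^sup>+x. (\<integral>\<^sup>+y. exp (l * (f (x(i := y)) - e)) \<partial>M i) \<partial>PiM I M)"
    by (intro product_nn_integral_insert) auto
  also have "\<dots> \<le> (\<integral>\<^sup>+x. ennreal (exp (l * (W x - e))) * ennreal (exp (l\<^sup>2 * (c i)\<^sup>2 / 8)) \<partial>PiM I M)"
  proof (rule nn_integral_mono)
    fix x assume x: "x \<in> space (PiM I M)"
    note [measurable] = slice[OF x]
    have "(\<integral>\<^sup>+y. exp (l * (f (x(i := y)) - e)) \<partial>M i)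
       = (\<integral>\<^sup>+y. ennreal (exp (l * (W x - e))) * ennreal (exp (l * (f (x(i := y)) - W x))) \<partial>M i)"
      by (intro nn_integral_cong) (simp add: ennreal_mult[symmetric] exp_add[symmetric] algebra_simps)
    also have "\<dots> = ennreal (exp (l * (W x - e))) * (\<integral>\<^sup>+y. ennreal (exp (l * (f (x(i := y)) - W x))) \<partial>M i)"
      by (rule nn_integral_cmult) measurable
    also have "(\<integral>\<^sup>+y. ennreal (exp (l * (f (x(i := y)) - W x))) \<partial>M i) \<le> ennreal (exp (l\<^sup>2 * (c i)\<^sup>2 / 8))"
      unfolding W_def
    proof (rule M.nn_integral_exp_bounded_range[OF slice[OF x] l])
      fix y y' assume y: "y \<in> space (M i)" "y' \<in> space (M i)"
      show "\<bar>f (x(i := y)) - f (x(i := y'))\<bar> \<le> c i"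
        using bounded_differencesD[OF insert.prems(2) insertI1 upd[OF x y(2)] y(1)]
        by (simp only: fun_upd_upd)
    qed
    finally show "(\<integral>\<^sup>+y. exp (l * (f (x(i := y)) - e)) \<partial>M i)
        \<le> ennreal (exp (l * (W x - e))) * ennreal (exp (l\<^sup>2 * (c i)\<^sup>2 / 8))"
      by (simp add: mult_left_mono)
  qed
  also have "\<dots> = (\<integral>\<^sup>+x. ennreal (exp (l * (W x - e))) \<partial>PiM I M) * ennreal (exp (l\<^sup>2 * (c i)\<^sup>2 / 8))"
    by (rule nn_integral_multc) measurable
  also have "\<dots> \<le> ennreal (exp (l\<^sup>2 * (\<Sum>i\<in>I. (c i)\<^sup>2) / 8)) * ennreal (exp (l\<^sup>2 * (c i)\<^sup>2 / 8))"
    unfolding e_def by (intro mult_right_mono insert.IH W W_bd) auto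
  also have "\<dots> = ennreal (exp (l\<^sup>2 * (\<Sum>i\<in>insert i I. (c i)\<^sup>2) / 8))"
    by (simp add: ennreal_mult[symmetric] exp_add[symmetric] algebra_simps add_divide_distrib)
  finally show ?case
    by (simp add: EW e_def)
qed

theorem mcdiarmid_ge:
  fixes f :: "('i \<Rightarrow> 'a) \<Rightarrow> real"
  assumes M: "\<And>i. prob_space (M i)" and fin: "finite I"
    and f [measurable]: "f \<in> borel_measurable (PiM I M)" and bd: "bounded_differences M I f c"
    and pos: "(\<Sum>i\<in>I. (c i)\<^sup>2) > 0" and t: "t > 0"
  shows "measure (PiM I M) {x \<in> space (PiM I M). f x \<ge> integral\<^sup>L (PiM I M) f + t}
    \<le> exp (- 2 * t\<^sup>2 / (\<Sum>i\<in>I. (c i)\<^sup>2))"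
proof -
  interpret prob_space "PiM I M" by (intro prob_space_PiM M)
  define C where "C = (\<Sum>i\<in>I. (c i)\<^sup>2)"
  \<comment> \<open>The minimizer of the Chernoff exponent - l t + l^2 C / 8.\<close>
  define l where "l = 4 * t / C"
  have C: "C > 0" using pos by (simp add: C_def)
  then have l: "l > 0" using t by (simp add: l_def)
  let ?g = "\<lambda>x. f x - expectation f"
  have "emeasure (PiM I M) {x \<in> space (PiM I M). ?g x \<ge> t}
      \<le> ennreal (exp (- l * t)) * (\<integral>\<^sup>+x. ennreal (exp (l * ?g x)) * indicator (space (PiM I M)) x \<partial>PiM I M)"
    by (intro Chernoff_ineq_nn_integral_ge l) auto
  also have "(\<integral>\<^sup>+x. ennreal (exp (l * ?g x)) * indicator (space (PiM I M)) x \<partial>PiM I M)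
      = (\<integral>\<^sup>+x. ennreal (exp (l * ?g x)) \<partial>PiM I M)"
    by (intro nn_integral_cong) auto
  also have "ennreal (exp (- l * t)) * \<dots> \<le> ennreal (exp (- l * t)) * ennreal (exp (l\<^sup>2 * C / 8))"
    unfolding C_def by (intro mult_left_mono mcdiarmid_mgf[OF M fin f bd l]) auto
  also have "\<dots> = ennreal (exp (- l * t + l\<^sup>2 * C / 8))"
    by (simp add: ennreal_mult[symmetric] exp_add[symmetric])
  also have "- l * t + l\<^sup>2 * C / 8 = - 2 * t\<^sup>2 / C"
    using C by (simp add: l_def field_simps power2_eq_square)
  finally show ?thesis
    by (simp add: emeasure_eq_measure C_def algebra_simps)
qed

text \<open>The deviation solves exp (- 2 t^2 / (card I * c^2)) = \<eta>. The event is strict in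
  order to include \<open>c = 0\<close>: there \<open>f\<close> is constant and the event empty,
  whereas its non-strict version would have probability 1.\<close>

lemma mcdiarmid_confidence:
  fixes f :: "('i \<Rightarrow> 'a) \<Rightarrow> real"
  assumes M: "\<And>i. prob_space (M i)" and fin: "finite I" "I \<noteq> {}"
    and f [measurable]: "f \<in> borel_measurable (PiM I M)"
    and bd: "bounded_differences M I f (\<lambda>_. c)" and c: "c \<ge> 0" and \<eta>: "0 < \<eta>" "\<eta> < 1"
  shows "measure (PiM I M) {x \<in> space (PiM I M).
      f x > integral\<^sup>L (PiM I M) f + c * real (card I) * sqrt (ln (1 / \<eta>) / (2 * real (card I)))} \<le> \<eta>"
proof -
  interpret prob_space "PiM I M" by (intro prob_space_PiM M)
  have I: "real (card I) > 0" using fin by (simp add: card_gt_0_iff)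
  have ln: "ln (1 / \<eta>) > 0" using \<eta> by simp
  show ?thesis
  proof (cases "c = 0")
    case True
    have "f x \<le> expectation f" if x: "x \<in> space (PiM I M)" for x
    proof -
      have "f y = f x" if "y \<in> space (PiM I M)" for y
        using bounded_differences_dist[OF fin(1) bd that x] True by simp
      then have "expectation f = expectation (\<lambda>_. f x)"
        by (intro Bochner_Integration.integral_cong) auto
      then show ?thesis by (simp add: prob_space)
    qed
    then have *: "{x \<in> space (PiM I M). f x > expectation f} = {}" by (auto simp: not_less)
    show ?thesis using True \<eta> by (simp add: * del: Collect_empty_eq)
  next
    case False
    define t where "t = c * real (card I) * sqrt (ln (1 / \<eta>) / (2 * real (card I)))"
    have t: "t > 0" using False c I ln by (simp add: t_def)
    have C: "(\<Sum>i\<in>I. c\<^sup>2) > 0" using False I by simp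
    have "t\<^sup>2 = c\<^sup>2 * (real (card I))\<^sup>2 * (ln (1 / \<eta>) / (2 * real (card I)))"
      unfolding t_def power_mult_distrib using ln I by simp
    also have "\<dots> = (\<Sum>i\<in>I. c\<^sup>2) * ln (1 / \<eta>) / 2"
      using I by (simp add: power2_eq_square)
    finally have "- 2 * t\<^sup>2 / (\<Sum>i\<in>I. c\<^sup>2) = - ln (1 / \<eta>)"
      using C by (simp add: field_simps del: sum_constant)
    then have "exp (- 2 * t\<^sup>2 / (\<Sum>i\<in>I. c\<^sup>2)) = \<eta>"
      using \<eta> by (simp add: ln_div)
    then have "prob {x \<in> space (PiM I M). f x \<ge> expectation f + t} \<le> \<eta>"
      using mcdiarmid_ge[OF M fin(1) f bd C t] by simp
    moreover have "prob {x \<in> space (PiM I M). f x > expectation f + t}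
        \<le> prob {x \<in> space (PiM I M). f x \<ge> expectation f + t}"
      by (intro finite_measure_mono) auto
    ultimately show ?thesis by (simp add: t_def)
  qed
qed

subsection \<open>Order statistics\<close>

lemma rank_weight_nonneg: "0 \<le> rank_weight n s q j"
  by (simp add: rank_weight_def sum_nonneg)

text \<open>A random s-subset contains j with probability s/n, and admitting only the cases with
  fewer than q smaller elements can only lower this. In formulas: the full sum over \<open>l\<close>
  is Vandermonde's identity for n - 1 = (j - 1) + (n - j), and absorption turns the resulting
  quotient of binomials into s/n.\<close>

lemma rank_weight_le:
  assumes j: "1 \<le> j" "j \<le> n" and qs: "q \<le> s" and s: "1 \<le> s" "s \<le> n"
  shows "rank_weight n s q j \<le> real s / real n"
proof -
  have "(\<Sum>l<q. ((j - 1) choose l) * ((n - j) choose (s - l - 1)))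
      \<le> (\<Sum>l\<le>s - 1. ((j - 1) choose l) * ((n - j) choose (s - 1 - l)))"
    using qs s by (intro order.trans[OF _ sum_mono2[of "{..s - 1}" "{..<q}"]] sum_mono)
      (auto simp: diff_commute)
  also have "\<dots> = (n - 1) choose (s - 1)"
    using j by (subst vandermonde) simp
  finally have "(\<Sum>l<q. real ((j - 1) choose l) * real ((n - j) choose (s - l - 1)))
      \<le> real ((n - 1) choose (s - 1))"
    by (simp only: of_nat_mult[symmetric] of_nat_sum[symmetric] of_nat_le_iff)
  also have "real s * real (n choose s) = real n * real ((n - 1) choose (s - 1))"
    using times_binomial_minus1_eq[of s n] s by (simp only: of_nat_mult[symmetric])
  then have "real ((n - 1) choose (s - 1)) = real s / real n * real (n choose s)"
    using j by (simp add: field_simps)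
  finally show ?thesis
    using s by (simp add: rank_weight_def divide_le_eq)
qed

text \<open>The sorting condition for a single vector, so that the order statistics of two loss
  vectors can be compared although their sorting permutations, and the way they break ties, are
  unrelated.\<close>

definition decreasing_order :: "nat \<Rightarrow> (nat \<Rightarrow> real) \<Rightarrow> (nat \<Rightarrow> nat) \<Rightarrow> bool" where
  "decreasing_order n a \<sigma> \<longleftrightarrow> \<sigma> permutes {1..n} \<and>
     (\<forall>j k. 1 \<le> j \<and> j \<le> k \<and> k \<le> n \<longrightarrow> a (\<sigma> j) \<ge> a (\<sigma> k))"

text \<open>A counting argument. Were the claim false, each of the j indices ranked first by
  \<open>\<sigma>\<close> would have a \<open>b\<close>-value above \<open>b (\<tau> j)\<close> and
  hence a \<open>\<tau>\<close>-rank below j, but only j - 1 such ranks exist.\<close>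

lemma order_statistic_mono:
  assumes \<sigma>: "decreasing_order n a \<sigma>" and \<tau>: "decreasing_order n b \<tau>"
    and le: "\<And>i. i \<in> {1..n} \<Longrightarrow> a i \<le> b i" and j: "j \<in> {1..n}"
  shows "a (\<sigma> j) \<le> b (\<tau> j)"
proof (rule ccontr)
  assume "\<not> ?thesis"
  then have gt: "b (\<tau> j) < a (\<sigma> j)" by simp
  have p: "\<sigma> permutes {1..n}" "\<tau> permutes {1..n}"
    using \<sigma> \<tau> by (auto simp: decreasing_order_def)
  have "\<sigma> ` {1..j} \<subseteq> \<tau> ` {1..<j}"
  proof
    fix i assume "i \<in> \<sigma> ` {1..j}"
    then obtain k where k: "k \<in> {1..j}" "i = \<sigma> k" by auto
    have i: "i \<in> {1..n}" using k j permutes_in_image[OF p(1), of k] by auto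
    then obtain m where m: "m \<in> {1..n}" "i = \<tau> m"
      using permutes_image[OF p(2)] by blast
    have "a (\<sigma> j) \<le> a (\<sigma> k)"
      using \<sigma> k j by (auto simp: decreasing_order_def)
    then have "b (\<tau> j) < b (\<tau> m)"
      using gt le[OF i] k m by simp
    then have "m < j"
      using \<tau> m j by (force simp: decreasing_order_def not_less)
    then show "i \<in> \<tau> ` {1..<j}" using m by auto
  qed
  then have "card (\<sigma> ` {1..j}) \<le> card (\<tau> ` {1..<j})"
    by (intro card_mono) auto
  also have "\<dots> \<le> j - 1"
    using card_image_le[of "{1..<j}" \<tau>] by simp
  finally show False
    using j by (auto simp: card_image permutes_inj_on[OF p(1)])
qed

text \<open>The increments at all ranks are nonnegative, so every weight may be raised to
  \<open>W\<close>; the unweighted sum over ranks is then a sum over samples, because permutations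
  preserve it. One changed loss thus costs \<open>W\<close> times its change in total, not once per
  rank.\<close>

lemma weighted_order_statistics_mono:
  assumes \<sigma>: "decreasing_order n a \<sigma>" and \<tau>: "decreasing_order n b \<tau>"
    and le: "\<And>i. i \<in> {1..n} \<Longrightarrow> a i \<le> b i"
    and w: "\<And>j. j \<in> {1..n} \<Longrightarrow> 0 \<le> w j \<and> w j \<le> W"
  shows "0 \<le> (\<Sum>j=1..n. w j * b (\<tau> j)) - (\<Sum>j=1..n. w j * a (\<sigma> j))"
    and "(\<Sum>j=1..n. w j * b (\<tau> j)) - (\<Sum>j=1..n. w j * a (\<sigma> j)) \<le> W * (\<Sum>i=1..n. b i - a i)"
proof -
  have p: "\<sigma> permutes {1..n}" "\<tau> permutes {1..n}"
    using \<sigma> \<tau> by (auto simp: decreasing_order_def)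
  have eq: "(\<Sum>j=1..n. w j * b (\<tau> j)) - (\<Sum>j=1..n. w j * a (\<sigma> j))
      = (\<Sum>j=1..n. w j * (b (\<tau> j) - a (\<sigma> j)))"
    by (simp add: sum_subtractf right_diff_distrib)
  note mono = order_statistic_mono[OF \<sigma> \<tau> le]
  show "0 \<le> (\<Sum>j=1..n. w j * b (\<tau> j)) - (\<Sum>j=1..n. w j * a (\<sigma> j))"
    unfolding eq using mono w by (intro sum_nonneg mult_nonneg_nonneg) auto
  have "(\<Sum>j=1..n. w j * (b (\<tau> j) - a (\<sigma> j))) \<le> (\<Sum>j=1..n. W * (b (\<tau> j) - a (\<sigma> j)))"
    using mono w by (intro sum_mono mult_right_mono) auto
  also have "\<dots> = W * ((\<Sum>j=1..n. b (\<tau> j)) - (\<Sum>j=1..n. a (\<sigma> j)))"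
    by (simp add: sum_subtractf sum_distrib_left right_diff_distrib)
  also have "\<dots> = W * (\<Sum>i=1..n. b i - a i)"
    using sum.permute[OF p(1), of a] sum.permute[OF p(2), of b] by (simp add: sum_subtractf o_def)
  finally show "(\<Sum>j=1..n. w j * b (\<tau> j)) - (\<Sum>j=1..n. w j * a (\<sigma> j)) \<le> W * (\<Sum>i=1..n. b i - a i)"
    unfolding eq .
qed

lemma weighted_order_statistics_diff:
  assumes \<sigma>: "decreasing_order n a \<sigma>" and \<tau>: "decreasing_order n b \<tau>"
    and i: "i \<in> {1..n}" and eq: "\<And>k. k \<in> {1..n} \<Longrightarrow> k \<noteq> i \<Longrightarrow> a k = b k"
    and m: "\<bar>a i - b i\<bar> \<le> m"
    and w: "\<And>j. j \<in> {1..n} \<Longrightarrow> 0 \<le> w j \<and> w j \<le> W"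
  shows "\<bar>(\<Sum>j=1..n. w j * b (\<tau> j)) - (\<Sum>j=1..n. w j * a (\<sigma> j))\<bar> \<le> W * m"
proof -
  have W: "0 \<le> W" using w[OF i] by linarith
  have sum: "(\<Sum>k=1..n. b k - a k) = b i - a i"
    using i eq by (subst sum.remove[of _ i]) auto
  have Wm: "W * \<bar>b i - a i\<bar> \<le> W * m"
    using m W by (intro mult_left_mono) auto
  show ?thesis
  \<comment> \<open>Vectors that differ in one coordinate are comparable pointwise, so monotonicity
    applies in one direction or the other.\<close>
  proof (cases "a i \<le> b i")
    case True
    then have le: "a k \<le> b k" if "k \<in> {1..n}" for k using eq[OF that] by (cases "k = i") auto
    show ?thesis
      using weighted_order_statistics_mono[of n a \<sigma> b \<tau> w W, OF \<sigma> \<tau> le w] sum Wm True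
      by simp
  next
    case False
    then have le: "b k \<le> a k" if "k \<in> {1..n}" for k using eq[OF that] by (cases "k = i") auto
    have "(\<Sum>k=1..n. a k - b k) = a i - b i"
      using sum by (simp add: sum_subtractf)
    then show ?thesis
      using weighted_order_statistics_mono[of n b \<tau> a \<sigma> w W, OF \<tau> \<sigma> le w] Wm False
      by simp
  qed
qed

lemma ordered_indexesD:
  "ordered_indexes loss f n ord \<Longrightarrow> decreasing_order n (indiv_loss loss f \<theta> D) (ord \<theta> D)"
  by (auto simp: ordered_indexes_def decreasing_order_def)

lemma top_q_objective_diff:
  assumes ord: "ordered_indexes loss f n ord"
    and nsq: "1 \<le> q" "q \<le> s" "s \<le> n" and i: "i \<in> {1..n}"
    and eq: "\<And>k. k \<in> {1..n} \<Longrightarrow> k \<noteq> i \<Longrightarrow> indiv_loss loss f \<theta> D k = indiv_loss loss f \<theta> D' k"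
    and m: "\<bar>indiv_loss loss f \<theta> D i - indiv_loss loss f \<theta> D' i\<bar> \<le> m"
  shows "\<bar>top_q_objective loss f ord n s q \<theta> D' - top_q_objective loss f ord n s q \<theta> D\<bar>
    \<le> real s / (real n * real q) * m"
proof -
  let ?S = "\<lambda>D. \<Sum>j=1..n. rank_weight n s q j * indiv_loss loss f \<theta> D (ord \<theta> D j)"
  have "\<bar>?S D' - ?S D\<bar> \<le> real s / real n * m"
    using nsq by (intro weighted_order_statistics_diff[OF ordered_indexesD[OF ord]
        ordered_indexesD[OF ord] i eq m] conjI rank_weight_nonneg rank_weight_le) auto
  then have "(1 / real q) * \<bar>?S D' - ?S D\<bar> \<le> (1 / real q) * (real s / real n * m)"
    by (intro mult_left_mono) auto
  moreover have "\<bar>top_q_objective loss f ord n s q \<theta> D' - top_q_objective loss f ord n s q \<theta> D\<bar>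
      = (1 / real q) * \<bar>?S D' - ?S D\<bar>"
    unfolding top_q_objective_def right_diff_distrib[symmetric] abs_mult by simp
  ultimately show ?thesis by (simp add: mult.commute)
qed

text \<open>Exchanges summation over ranks with summation over samples; each rank selects exactly
  one sample. It identifies the reweighted sum inside \<open>Q_term\<close> with the top-q objective
  of the corrupted data.\<close>

lemma top_q_objective_eq_sample_weights:
  assumes ord: "ordered_indexes loss f n ord" and n: "n > 0"
  shows "top_q_objective loss f ord n s q \<theta> D
    = (1 / real n) * (\<Sum>i=1..n. sample_weight ord n s q \<theta> D i * real n / real q * indiv_loss loss f \<theta> D i)"
proof -
  have p: "ord \<theta> D permutes {1..n}" using ord by (auto simp: ordered_indexes_def)
  have "(\<Sum>i=1..n. sample_weight ord n s q \<theta> D i * indiv_loss loss f \<theta> D i)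
      = (\<Sum>i=1..n. \<Sum>j=1..n. if i = ord \<theta> D j then rank_weight n s q j * indiv_loss loss f \<theta> D i else 0)"
    unfolding sample_weight_def sum_distrib_right by (intro sum.cong) auto
  also have "\<dots> = (\<Sum>j=1..n. \<Sum>i=1..n. if i = ord \<theta> D j then rank_weight n s q j * indiv_loss loss f \<theta> D i else 0)"
    by (rule sum.swap)
  also have "\<dots> = (\<Sum>j=1..n. rank_weight n s q j * indiv_loss loss f \<theta> D (ord \<theta> D j))"
    using permutes_in_image[OF p] by (intro sum.cong refl) (simp add: sum.delta)
  finally have "(\<Sum>i=1..n. sample_weight ord n s q \<theta> D i * indiv_loss loss f \<theta> D i)
      = (\<Sum>j=1..n. rank_weight n s q j * indiv_loss loss f \<theta> D (ord \<theta> D j))" .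
  moreover have "(1 / real n) * (\<Sum>i=1..n. sample_weight ord n s q \<theta> D i * real n / real q * indiv_loss loss f \<theta> D i)
     = (1 / real q) * (\<Sum>i=1..n. sample_weight ord n s q \<theta> D i * indiv_loss loss f \<theta> D i)"
    unfolding sum_distrib_left using n by (intro sum.cong) auto
  ultimately show ?thesis
    by (simp add: top_q_objective_def)
qed

subsection \<open>Symmetrization\<close>

lemma measurable_coordinate_choice:
  "(\<lambda>(x, y). \<lambda>i\<in>I. if i \<in> J then x i else y i) \<in> PiM I M \<Otimes>\<^sub>M PiM I M \<rightarrow>\<^sub>M PiM I M"
    (is "?T \<in> ?P \<rightarrow>\<^sub>M _")
proof (rule measurable_PiM_single')
  show "(\<lambda>p. ?T p i) \<in> ?P \<rightarrow>\<^sub>M M i" if "i \<in> I" for i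
    using that by (cases "i \<in> J") (auto simp: case_prod_beta)
qed (auto simp: space_pair_measure space_PiM)

text \<open>Each coordinate is taken from just one of two independent copies, which keeps the
  coordinates independent with the same laws. The preimage of a box is a product of two boxes with
  complementary constraints, and the unconstrained slots have measure 1.\<close>

lemma distr_PiM_coordinate_choice:
  assumes M: "\<And>i. prob_space (M i)" and fin: "finite I"
  shows "distr (PiM I M \<Otimes>\<^sub>M PiM I M) (PiM I M) (\<lambda>(x, y). \<lambda>i\<in>I. if i \<in> J then x i else y i) = PiM I M"
    (is "distr ?P _ ?T = _")
proof -
  interpret product_prob_space M I
    by (intro product_prob_space.intro product_prob_space_axioms.intro product_sigma_finite.intro
        prob_space_imp_sigma_finite M)
  note T = measurable_coordinate_choice[of I J M]
  show ?thesis
  proof (rule PiM_eqI[OF fin])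
    fix A assume A: "\<And>i. i \<in> I \<Longrightarrow> A i \<in> sets (M i)"
    let ?A1 = "\<lambda>i. if i \<in> J then A i else space (M i)"
    let ?A2 = "\<lambda>i. if i \<in> J then space (M i) else A i"
    have pre: "?T -` Pi\<^sub>E I A \<inter> space ?P = Pi\<^sub>E I ?A1 \<times> Pi\<^sub>E I ?A2"
      using A[THEN sets.sets_into_space]
      by (fastforce simp: space_pair_measure space_PiM PiE_iff extensional_def split: if_splits)
    have "emeasure (distr ?P (PiM I M) ?T) (Pi\<^sub>E I A) = emeasure ?P (Pi\<^sub>E I ?A1 \<times> Pi\<^sub>E I ?A2)"
      unfolding pre[symmetric] using A fin by (intro emeasure_distr T sets_PiM_I_finite) auto
    also have "\<dots> = emeasure (PiM I M) (Pi\<^sub>E I ?A1) * emeasure (PiM I M) (Pi\<^sub>E I ?A2)"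
      using A fin by (intro sets_PiM_I_finite sigma_finite_measure.emeasure_pair_measure_Times
          prob_space_imp_sigma_finite prob_space_PiM M) auto
    also have "\<dots> = (\<Prod>i\<in>I. emeasure (M i) (?A1 i)) * (\<Prod>i\<in>I. emeasure (M i) (?A2 i))"
      using A fin by (subst (1 2) emeasure_PiM) auto
    also have "\<dots> = (\<Prod>i\<in>I. emeasure (M i) (A i))"
      unfolding prod.distrib[symmetric]
      by (intro prod.cong) (auto simp: prob_space.emeasure_space_1[OF M])
    finally show "emeasure (distr ?P (PiM I M) ?T) (Pi\<^sub>E I A) = (\<Prod>i\<in>I. emeasure (M i) (A i))" .
  qed simp
qed

text \<open>
  Swapping the coordinates of \<open>D\<close> and of a ghost sample at the negative signs turns the difference of
  the two empirical means into one with signs \<open>\<xi>\<close>. Doing this under the integral for one fixed \<open>\<xi>\<close>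
  gives a measurable majorant, although the supremum over \<open>\<theta>\<close> of the differences need not be
  measurable.
\<close>

lemma symmetrization_majorant:
  fixes h :: "'t \<Rightarrow> 'a \<Rightarrow> real" and \<xi> :: "'i \<Rightarrow> real" and U V :: "('i \<Rightarrow> 'a) \<Rightarrow> real"
  assumes P: "prob_space P" and I: "finite I" "I \<noteq> {}"
    and h: "\<And>\<theta>. \<theta> \<in> \<Theta> \<Longrightarrow> integrable P (h \<theta>)"
    and \<xi>: "\<And>i. i \<in> I \<Longrightarrow> \<xi> i = -1 \<or> \<xi> i = 1"
    and U [measurable]: "U \<in> borel_measurable (PiM I (\<lambda>_. P))"
    and V [measurable]: "V \<in> borel_measurable (PiM I (\<lambda>_. P))"
    and UV_bound: "\<And>D. D \<in> space (PiM I (\<lambda>_. P)) \<Longrightarrow> \<bar>U D\<bar> \<le> C \<and> \<bar>V D\<bar> \<le> C"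
    and U_ge: "\<And>D \<theta>. D \<in> space (PiM I (\<lambda>_. P)) \<Longrightarrow> \<theta> \<in> \<Theta> \<Longrightarrow>
      1 / real (card I) * (\<Sum>i\<in>I. \<xi> i * h \<theta> (D i)) \<le> U D"
    and V_ge: "\<And>D \<theta>. D \<in> space (PiM I (\<lambda>_. P)) \<Longrightarrow> \<theta> \<in> \<Theta> \<Longrightarrow>
      1 / real (card I) * (\<Sum>i\<in>I. - \<xi> i * h \<theta> (D i)) \<le> V D"
  obtains G where "integrable (PiM I (\<lambda>_. P)) G"
    and "integral\<^sup>L (PiM I (\<lambda>_. P)) G = integral\<^sup>L (PiM I (\<lambda>_. P)) U + integral\<^sup>L (PiM I (\<lambda>_. P)) V"
    and "\<And>D \<theta>. D \<in> space (PiM I (\<lambda>_. P)) \<Longrightarrow> \<theta> \<in> \<Theta> \<Longrightarrow>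
      integral\<^sup>L P (h \<theta>) - 1 / real (card I) * (\<Sum>i\<in>I. h \<theta> (D i)) \<le> G D"
proof -
  let ?M = "PiM I (\<lambda>_. P)"
  interpret PS: prob_space P by fact
  interpret M: prob_space ?M by (intro prob_space_PiM P)
  interpret MM: pair_prob_space ?M ?M ..
  interpret PP: product_prob_space "\<lambda>_. P" I
    by (intro product_prob_space.intro product_prob_space_axioms.intro product_sigma_finite.intro
        prob_space_imp_sigma_finite P)
  define T where "T J = (\<lambda>(x, y). \<lambda>i\<in>I. if i \<in> J then x i else y i :: 'a)" for J :: "'i set"
  have T [measurable]: "T J \<in> ?M \<Otimes>\<^sub>M ?M \<rightarrow>\<^sub>M ?M" for J
    unfolding T_def by (rule measurable_coordinate_choice)
  have distr_T: "distr (?M \<Otimes>\<^sub>M ?M) ?M (T J) = ?M" for J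
    unfolding T_def by (rule distr_PiM_coordinate_choice[OF P I(1)])
  have T_space: "T J (x, y) \<in> space ?M" if "x \<in> space ?M" "y \<in> space ?M" for J x y
    using measurable_space[OF T, of "(x, y)" J] that by (auto simp: space_pair_measure)
  \<comment> \<open>\<open>T J\<close> takes \<open>D\<close> at the negative signs and the ghost
    sample elsewhere, \<open>T (- J)\<close> the opposite. The two mixtures are dependent, but each
    has the law of a sample, and linearity of the integral then gives the mean of
    \<open>G\<close>.\<close>
  define J where "J = {i. \<xi> i = -1}"
  define G where "G D = (\<integral>D'. U (T J (D, D')) + V (T (- J) (D, D')) \<partial>?M)" for D
  have U_int: "integrable ?M U" and V_int: "integrable ?M V"
    using UV_bound by (auto intro!: M.integrable_const_bound[where B = C])
  have UT: "integrable (?M \<Otimes>\<^sub>M ?M) (\<lambda>p. U (T J p))" "integral\<^sup>L (?M \<Otimes>\<^sub>M ?M) (\<lambda>p. U (T J p)) = integral\<^sup>L ?M U" for J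
    using U_int integrable_distr[of "T J" "?M \<Otimes>\<^sub>M ?M" ?M U] integral_distr[of "T J" "?M \<Otimes>\<^sub>M ?M" ?M U]
    by (auto simp: distr_T)
  have VT: "integrable (?M \<Otimes>\<^sub>M ?M) (\<lambda>p. V (T J p))" "integral\<^sup>L (?M \<Otimes>\<^sub>M ?M) (\<lambda>p. V (T J p)) = integral\<^sup>L ?M V" for J
    using V_int integrable_distr[of "T J" "?M \<Otimes>\<^sub>M ?M" ?M V] integral_distr[of "T J" "?M \<Otimes>\<^sub>M ?M" ?M V]
    by (auto simp: distr_T)
  have int: "integrable (?M \<Otimes>\<^sub>M ?M) (\<lambda>p. U (T J p) + V (T (- J) p))"
    using UT VT by auto
  show ?thesis
  proof (rule that)
    show "integrable ?M G"
      unfolding G_def by (rule MM.integrable_fst'[OF int])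
    have "integral\<^sup>L ?M G = integral\<^sup>L (?M \<Otimes>\<^sub>M ?M) (\<lambda>p. U (T J p) + V (T (- J) p))"
      unfolding G_def by (rule MM.integral_fst'[OF int])
    then show "integral\<^sup>L ?M G = integral\<^sup>L ?M U + integral\<^sup>L ?M V"
      using UT VT by simp
  next
    fix D \<theta> assume D: "D \<in> space ?M" and \<theta>: "\<theta> \<in> \<Theta>"
    let ?c = "1 / real (card I)"
    have cI: "real (card I) > 0" using I by (simp add: card_gt_0_iff)
    have comp: "integrable ?M (\<lambda>D'. h \<theta> (D' i))" "(\<integral>D'. h \<theta> (D' i) \<partial>?M) = integral\<^sup>L P (h \<theta>)"
      if i: "i \<in> I" for i
    proof -
      have d: "distr ?M P (\<lambda>D'. D' i) = P" using PP.PiM_component[OF i] .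
      show "integrable ?M (\<lambda>D'. h \<theta> (D' i))"
        using i h[OF \<theta>] by (subst integrable_distr_eq[symmetric, where N = P]) (auto simp: d)
      show "(\<integral>D'. h \<theta> (D' i) \<partial>?M) = integral\<^sup>L P (h \<theta>)"
        using i h[OF \<theta>] by (subst integral_distr[symmetric, where N = P]) (auto simp: d)
    qed
    \<comment> \<open>The risk is the mean of the ghost sample's empirical risk, so the deviation
      becomes an integral over \<open>D'\<close> that can be compared with \<open>G\<close> under
      the integral sign.\<close>
    have "integral\<^sup>L P (h \<theta>) - ?c * (\<Sum>i\<in>I. h \<theta> (D i)) = (\<integral>D'. ?c * (\<Sum>i\<in>I. h \<theta> (D' i) - h \<theta> (D i)) \<partial>?M)"
      using comp cI by (simp add: sum_subtractf M.prob_space field_simps)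
    also have "\<dots> \<le> G D"
      unfolding G_def
    proof (rule integral_mono)
      show "integrable ?M (\<lambda>D'. ?c * (\<Sum>i\<in>I. h \<theta> (D' i) - h \<theta> (D i)))"
        using comp by (intro integrable_mult_right Bochner_Integration.integrable_sum
            Bochner_Integration.integrable_diff) auto
      note [measurable] = D
      have "\<bar>U (T J (D, D')) + V (T (- J) (D, D'))\<bar> \<le> 2 * C" if "D' \<in> space ?M" for D'
        using UV_bound[OF T_space[OF D that, of J]] UV_bound[OF T_space[OF D that, of "- J"]] by linarith
      then show "integrable ?M (\<lambda>D'. U (T J (D, D')) + V (T (- J) (D, D')))"
        by (intro M.integrable_const_bound[where B = "2 * C"]) auto
      fix D' assume D': "D' \<in> space ?M"
      let ?x = "T J (D, D')" and ?y = "T (- J) (D, D')"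
      \<comment> \<open>At a negative sign \<open>?x i = D i\<close> and \<open>?y i = D' i\<close>,
        at a positive sign the reverse; in both cases the two signed terms add up to the summand on
        the left.\<close>
      have "(\<Sum>i\<in>I. h \<theta> (D' i) - h \<theta> (D i)) = (\<Sum>i\<in>I. \<xi> i * h \<theta> (?x i)) + (\<Sum>i\<in>I. - \<xi> i * h \<theta> (?y i))"
        unfolding sum.distrib[symmetric]
        using \<xi> by (intro sum.cong refl) (force simp: T_def J_def)
      then show "?c * (\<Sum>i\<in>I. h \<theta> (D' i) - h \<theta> (D i)) \<le> U ?x + V ?y"
        using U_ge[OF T_space[OF D D'] \<theta>] V_ge[OF T_space[OF D D'] \<theta>]
        by (simp only: distrib_left add_mono)
    qed
    finally show "integral\<^sup>L P (h \<theta>) - ?c * (\<Sum>i\<in>I. h \<theta> (D i)) \<le> G D" .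
  qed
qed

subsection \<open>The generalization bound\<close>

lemma cSUP_dist_le:
  fixes f g :: "'a \<Rightarrow> real"
  assumes "A \<noteq> {}" and bdd: "bdd_above (f ` A)" "bdd_above (g ` A)"
    and le: "\<And>x. x \<in> A \<Longrightarrow> \<bar>f x - g x\<bar> \<le> c"
  shows "\<bar>(SUP x\<in>A. f x) - (SUP x\<in>A. g x)\<bar> \<le> c"
proof -
  have *: "(SUP x\<in>A. u x) \<le> (SUP x\<in>A. v x) + c"
    if "bdd_above (v ` A)" "\<And>x. x \<in> A \<Longrightarrow> \<bar>u x - v x\<bar> \<le> c" for u v :: "'a \<Rightarrow> real"
  proof (rule cSUP_least[OF \<open>A \<noteq> {}\<close>])
    fix x assume "x \<in> A"
    then show "u x \<le> (SUP x\<in>A. v x) + c"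
      using cSUP_upper[OF _ that(1), of x] that(2)[of x] by linarith
  qed
  show ?thesis
    using *[of g f] *[of f g] bdd le by (fastforce simp: abs_le_iff)
qed

lemma cINF_dist_le:
  fixes f g :: "'a \<Rightarrow> real"
  assumes "A \<noteq> {}" and bdd: "bdd_below (f ` A)" "bdd_below (g ` A)"
    and le: "\<And>x. x \<in> A \<Longrightarrow> \<bar>f x - g x\<bar> \<le> c"
  shows "\<bar>(INF x\<in>A. f x) - (INF x\<in>A. g x)\<bar> \<le> c"
proof -
  have *: "(INF x\<in>A. u x) - c \<le> (INF x\<in>A. v x)"
    if "bdd_below (u ` A)" "\<And>x. x \<in> A \<Longrightarrow> \<bar>u x - v x\<bar> \<le> c" for u v :: "'a \<Rightarrow> real"
  proof (rule cINF_greatest[OF \<open>A \<noteq> {}\<close>])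
    fix x assume "x \<in> A"
    then show "(INF x\<in>A. u x) - c \<le> v x"
      using cINF_lower[OF that(1), of x] that(2)[of x] by linarith
  qed
  show ?thesis
    using *[of g f] *[of f g] bdd le by (fastforce simp: abs_le_iff)
qed

lemma bounded_differences_minus:
  assumes "bounded_differences M I f c"
  shows "bounded_differences M I (\<lambda>x. - f x) c"
  using assms unfolding bounded_differences_def by (smt (verit))

section \<open>Infinite Rademacher complexity for unbounded losses\<close>

lemma rademacher_sup_unbounded:
  assumes n: "n > 0" and D: "\<And>i. i \<in> {1..n} \<Longrightarrow> D i \<in> S"
    and osc: "\<And>\<theta> z z'. \<theta> \<in> \<Theta> \<Longrightarrow> z \<in> S \<Longrightarrow> z' \<in> S \<Longrightarrow>
      \<bar>loss (f (fst z) \<theta>) (snd z) - loss (f (fst z') \<theta>) (snd z')\<bar> \<le> M"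
    and unb: "\<And>B. \<exists>\<theta>\<in>\<Theta>. \<exists>z\<in>S. loss (f (fst z) \<theta>) (snd z) > B"
  shows "rademacher_sup loss f n \<Theta> D (\<lambda>i\<in>{1..n}. 1) = \<infinity>"
  unfolding rademacher_sup_def
proof (rule SUP_PInfty)
  fix N :: nat
  \<comment> \<open>The surplus \<open>M\<close> absorbs the oscillation: one loss above
    \<open>real N + M\<close> forces all sample losses at the same \<theta> above
    \<open>real N\<close>, and with all signs equal to 1 nothing cancels.\<close>
  obtain \<theta> z where \<theta>: "\<theta> \<in> \<Theta>" and z: "z \<in> S" and gt: "loss (f (fst z) \<theta>) (snd z) > real N + M"
    using unb by blast
  have "real N \<le> indiv_loss loss f \<theta> D i" if "i \<in> {1..n}" for i
    using osc[OF \<theta> z D[OF that]] gt by (simp add: indiv_loss_def)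
  then have "(\<Sum>i=1..n. real N) \<le> (\<Sum>i=1..n. (\<lambda>i\<in>{1..n}. 1) i * indiv_loss loss f \<theta> D i)"
    by (intro sum_mono) simp
  then have "real N \<le> (1 / real n) * (\<Sum>i=1..n. (\<lambda>i\<in>{1..n}. 1) i * indiv_loss loss f \<theta> D i)"
    using n by (simp add: field_simps)
  then show "\<exists>\<theta>\<in>\<Theta>. ereal (real N) \<le> ereal ((1 / real n) * (\<Sum>i=1..n. (\<lambda>i\<in>{1..n}. 1) i * indiv_loss loss f \<theta> D i))"
    using \<theta> by auto
qed

text \<open>One infinite summand makes a finite sum of extended reals infinite, so a single sign
  vector decides.\<close>

lemma emp_rademacher_infinite:
  assumes "\<xi> \<in> {1..n} \<rightarrow>\<^sub>E {-1, 1}" "rademacher_sup loss f n \<Theta> D \<xi> = \<infinity>"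
  shows "emp_rademacher loss f n \<Theta> D = \<infinity>"
proof -
  have "(\<Sum>\<xi>\<in>{1..n} \<rightarrow>\<^sub>E {-1, 1}. rademacher_sup loss f n \<Theta> D \<xi>) = \<infinity>"
    unfolding sum_Pinfty using assms by (auto intro!: finite_PiE)
  moreover have "(2 :: ereal) ^ n = ereal (2 ^ n)"
    by (metis ereal_power numeral_eq_ereal)
  ultimately show ?thesis
    by (simp add: emp_rademacher_def)
qed

section \<open>Uniformly bounded losses\<close>

locale bounded_loss_sample = prob_space P
  for P :: "('x \<times> 'y) measure" +
  fixes f :: "'x \<Rightarrow> 't \<Rightarrow> 'y" and loss :: "'y \<Rightarrow> 'y \<Rightarrow> real" and n s q :: nat
    and gx :: "nat \<Rightarrow> 'x \<Rightarrow> 'x" and gy :: "nat \<Rightarrow> 'y \<Rightarrow> 'y" and \<Theta> :: "'t set"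
    and ord :: "'t \<Rightarrow> (nat \<Rightarrow> 'x \<times> 'y) \<Rightarrow> nat \<Rightarrow> nat" and M B :: real
  assumes loss_meas: "\<And>\<theta>. \<theta> \<in> \<Theta> \<Longrightarrow> (\<lambda>z. loss (f (fst z) \<theta>) (snd z)) \<in> borel_measurable P"
    and loss_nonneg: "\<And>\<theta> z. \<theta> \<in> \<Theta> \<Longrightarrow> z \<in> space P \<Longrightarrow> 0 \<le> loss (f (fst z) \<theta>) (snd z)"
    and loss_le: "\<And>\<theta> z. \<theta> \<in> \<Theta> \<Longrightarrow> z \<in> space P \<Longrightarrow> loss (f (fst z) \<theta>) (snd z) \<le> B"
    and loss_osc: "\<And>\<theta> z z'. \<theta> \<in> \<Theta> \<Longrightarrow> z \<in> space P \<Longrightarrow> z' \<in> space P \<Longrightarrow>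
      \<bar>loss (f (fst z) \<theta>) (snd z) - loss (f (fst z') \<theta>) (snd z')\<bar> \<le> M"
    and nsq: "1 \<le> q" "q \<le> s" "s \<le> n"
    and corrupt_space: "\<And>i z. i \<in> {1..n} \<Longrightarrow> z \<in> space P \<Longrightarrow> (gx i (fst z), gy i (snd z)) \<in> space P"
    and Theta_nonempty: "\<Theta> \<noteq> {}"
    and ord: "ordered_indexes loss f n ord"
    and rademacher_sup_meas: "\<And>\<xi>. \<xi> \<in> {1..n} \<rightarrow>\<^sub>E {-1, 1} \<Longrightarrow>
      (\<lambda>D. rademacher_sup loss f n \<Theta> D \<xi>) \<in> borel_measurable (PiM {1..n} (\<lambda>_. P))"
    and corruption_inf_meas:
      "corruption_inf loss f ord n s q \<Theta> gx gy \<in> borel_measurable (PiM {1..n} (\<lambda>_. P))"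
    and gap_sup_meas:
      "(\<lambda>D. SUP \<theta>\<in>\<Theta>. population_risk loss f P \<theta> - top_q_objective loss f ord n s q \<theta> (corrupt gx gy D))
        \<in> borel_measurable (PiM {1..n} (\<lambda>_. P))"
begin

abbreviation "sample \<equiv> PiM {1..n} (\<lambda>_. P)"

abbreviation "signs \<equiv> {1..n} \<rightarrow>\<^sub>E {-1, 1 :: real}"

abbreviation "risk \<equiv> population_risk loss f P"

abbreviation "il \<equiv> indiv_loss loss f"

abbreviation "top_q \<equiv> top_q_objective loss f ord n s q"

definition gap :: "(nat \<Rightarrow> 'x \<times> 'y) \<Rightarrow> real" where
  "gap D = (SUP \<theta>\<in>\<Theta>. risk \<theta> - top_q \<theta> (corrupt gx gy D))"

text \<open>The real counterpart of \<open>rademacher_sup\<close>, as McDiarmid's inequality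
  concerns real functions. The bound \<open>B\<close> makes the supremum finite on the sample space;
  the constants of the final bound come from \<open>M\<close>.\<close>

definition rad_sup :: "(nat \<Rightarrow> real) \<Rightarrow> (nat \<Rightarrow> 'x \<times> 'y) \<Rightarrow> real" where
  "rad_sup \<xi> D = (SUP \<theta>\<in>\<Theta>. (1 / real n) * (\<Sum>i=1..n. \<xi> i * il \<theta> D i))"

definition emp_rad :: "(nat \<Rightarrow> 'x \<times> 'y) \<Rightarrow> real" where
  "emp_rad D = (\<Sum>\<xi>\<in>signs. rad_sup \<xi> D) / 2 ^ n"

lemma n_pos: "n > 0" using nsq by simp

lemma M_nonneg: "0 \<le> M"
proof -
  obtain \<theta> z where "\<theta> \<in> \<Theta>" "z \<in> space P" using Theta_nonempty not_empty by blast
  then show ?thesis using loss_osc[of \<theta> z z] by simp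
qed

lemma integrable_loss: "\<theta> \<in> \<Theta> \<Longrightarrow> integrable P (\<lambda>z. loss (f (fst z) \<theta>) (snd z))"
  using loss_meas loss_nonneg loss_le by (intro integrable_const_bound[where B = B]) auto

lemma sample_component: "D \<in> space sample \<Longrightarrow> i \<in> {1..n} \<Longrightarrow> D i \<in> space P"
  by (auto simp: space_PiM)

lemma corrupt_component: "D \<in> space sample \<Longrightarrow> i \<in> {1..n} \<Longrightarrow> corrupt gx gy D i \<in> space P"
  by (simp add: corrupt_def corrupt_space sample_component)

lemma il_bounds:
  assumes "\<theta> \<in> \<Theta>" "D i \<in> space P"
  shows "0 \<le> il \<theta> D i" "il \<theta> D i \<le> B"
  using assms loss_nonneg loss_le by (auto simp: indiv_loss_def)

lemma risk_le: "\<theta> \<in> \<Theta> \<Longrightarrow> risk \<theta> \<le> B"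
  unfolding population_risk_def
  using integral_mono[OF integrable_loss, of \<theta> "\<lambda>_. B"] loss_le by (simp add: prob_space)

lemma top_q_nonneg:
  assumes \<theta>: "\<theta> \<in> \<Theta>" and D: "\<And>i. i \<in> {1..n} \<Longrightarrow> D i \<in> space P"
  shows "0 \<le> top_q \<theta> D"
proof -
  have p: "ord \<theta> D permutes {1..n}" using ord by (auto simp: ordered_indexes_def)
  have "D (ord \<theta> D j) \<in> space P" if "j \<in> {1..n}" for j
    using permutes_in_image[OF p, of j] that D by auto
  then show ?thesis
    unfolding top_q_objective_def using il_bounds[OF \<theta>]
    by (intro mult_nonneg_nonneg sum_nonneg rank_weight_nonneg) auto
qed

lemma gap_bdd: "D \<in> space sample \<Longrightarrow> bdd_above ((\<lambda>\<theta>. risk \<theta> - top_q \<theta> (corrupt gx gy D)) ` \<Theta>)"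
  using risk_le top_q_nonneg corrupt_component by (intro bdd_aboveI2[of _ _ B]) (smt (verit))

lemma mean_signed_abs_le:
  assumes \<xi>: "\<xi> \<in> signs" and \<theta>: "\<theta> \<in> \<Theta>" and D: "D \<in> space sample"
  shows "\<bar>(1 / real n) * (\<Sum>i=1..n. \<xi> i * il \<theta> D i)\<bar> \<le> B"
proof -
  have "\<bar>\<xi> i * il \<theta> D i\<bar> \<le> B" if i: "i \<in> {1..n}" for i
    using PiE_mem[OF \<xi> i] il_bounds[of \<theta> D i, OF \<theta> sample_component[OF D i]] by auto
  then have "\<bar>\<Sum>i=1..n. \<xi> i * il \<theta> D i\<bar> \<le> (\<Sum>i=1..n. B)"
    by (intro order.trans[OF sum_abs] sum_mono) auto
  then show ?thesis
    using n_pos by (simp add: abs_mult field_simps)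
qed

lemma rad_bdd:
  assumes "\<xi> \<in> signs" "D \<in> space sample"
  shows "bdd_above ((\<lambda>\<theta>. (1 / real n) * (\<Sum>i=1..n. \<xi> i * il \<theta> D i)) ` \<Theta>)"
  by (intro bdd_aboveI2[of _ _ B] abs_le_D1[OF mean_signed_abs_le] assms)

lemma rad_sup_abs_le:
  assumes "\<xi> \<in> signs" "D \<in> space sample"
  shows "\<bar>rad_sup \<xi> D\<bar> \<le> B"
  unfolding rad_sup_def using Theta_nonempty mean_signed_abs_le[OF assms(1) _ assms(2)]
  by (intro cSup_abs_le) auto

lemma rademacher_sup_eq:
  assumes "\<xi> \<in> signs" "D \<in> space sample"
  shows "rademacher_sup loss f n \<Theta> D \<xi> = ereal (rad_sup \<xi> D)"
  unfolding rademacher_sup_def rad_sup_def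
proof (intro ereal_SUP[symmetric] ereal_SUP_not_infty[where l = "ereal (- B)" and u = "ereal B"] ballI)
  fix \<theta> assume "\<theta> \<in> \<Theta>"
  from mean_signed_abs_le[OF assms(1) this assms(2)]
  show "ereal (- B) \<le> ereal (1 / real n * (\<Sum>i = 1..n. \<xi> i * il \<theta> D i)) \<and>
      ereal (1 / real n * (\<Sum>i = 1..n. \<xi> i * il \<theta> D i)) \<le> ereal B"
    unfolding ereal_less_eq by linarith
qed (use Theta_nonempty in auto)

lemma emp_rademacher_eq:
  assumes "D \<in> space sample"
  shows "emp_rademacher loss f n \<Theta> D = ereal (emp_rad D)"
proof -
  have "(\<Sum>\<xi>\<in>signs. rademacher_sup loss f n \<Theta> D \<xi>) = ereal (\<Sum>\<xi>\<in>signs. rad_sup \<xi> D)"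
    unfolding sum_ereal[symmetric] using assms by (intro sum.cong refl rademacher_sup_eq)
  moreover have "(2 :: ereal) ^ n = ereal (2 ^ n)"
    by (metis ereal_power numeral_eq_ereal)
  ultimately show ?thesis
    by (simp add: emp_rademacher_def emp_rad_def)
qed

lemma rad_sup_meas: "\<xi> \<in> signs \<Longrightarrow> rad_sup \<xi> \<in> borel_measurable sample"
  using borel_measurable_real_of_ereal[OF rademacher_sup_meas, of \<xi>]
  by (subst measurable_cong[of _ _ "\<lambda>D. real_of_ereal (rademacher_sup loss f n \<Theta> D \<xi>)"])
    (simp_all add: rademacher_sup_eq)

lemma emp_rad_meas: "emp_rad \<in> borel_measurable sample"
  unfolding emp_rad_def using rad_sup_meas by (intro borel_measurable_divide borel_measurable_sum) auto

lemma gap_meas: "gap \<in> borel_measurable sample"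
  unfolding gap_def by (rule gap_sup_meas)

lemma card_signs: "card signs = 2 ^ n"
  by (simp add: card_PiE numeral_2_eq_2)

text \<open>The sign is constrained at the replaced index rather than by membership in
  \<open>signs\<close>, whose elements are \<open>undefined\<close> outside \<open>{1..n}\<close>;
  in this form the constant sign 1 covers the empirical risk as well.\<close>

lemma mean_signed_diff:
  assumes \<xi>: "\<xi> i = -1 \<or> \<xi> i = 1" and \<theta>: "\<theta> \<in> \<Theta>" and i: "i \<in> {1..n}"
    and D: "D \<in> space sample" and z: "z \<in> space P"
  shows "\<bar>(1 / real n) * (\<Sum>k=1..n. \<xi> k * il \<theta> (D(i := z)) k) - (1 / real n) * (\<Sum>k=1..n. \<xi> k * il \<theta> D k)\<bar>
    \<le> M / real n"
proof -
  have "(\<Sum>k=1..n. \<xi> k * il \<theta> (D(i := z)) k) - (\<Sum>k=1..n. \<xi> k * il \<theta> D k)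
      = (\<Sum>k=1..n. \<xi> k * il \<theta> (D(i := z)) k - \<xi> k * il \<theta> D k)"
    by (simp add: sum_subtractf)
  also have "\<dots> = \<xi> i * (il \<theta> (D(i := z)) i - il \<theta> D i)"
    using i by (subst sum.remove[of _ i]) (auto simp: indiv_loss_def right_diff_distrib)
  finally have "\<bar>(\<Sum>k=1..n. \<xi> k * il \<theta> (D(i := z)) k) - (\<Sum>k=1..n. \<xi> k * il \<theta> D k)\<bar> \<le> M"
    using \<xi> loss_osc[OF \<theta> z sample_component[OF D i]] by (auto simp: indiv_loss_def)
  then show ?thesis
    unfolding right_diff_distrib[symmetric] abs_mult using n_pos by (simp add: divide_right_mono)
qed

lemma top_q_corrupt_diff:
  assumes \<theta>: "\<theta> \<in> \<Theta>" and i: "i \<in> {1..n}" and D: "D \<in> space sample" and z: "z \<in> space P"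
  shows "\<bar>top_q \<theta> (corrupt gx gy (D(i := z))) - top_q \<theta> (corrupt gx gy D)\<bar> \<le> real s / (real n * real q) * M"
proof (rule top_q_objective_diff[OF ord nsq i])
  show "il \<theta> (corrupt gx gy D) k = il \<theta> (corrupt gx gy (D(i := z))) k" if "k \<noteq> i" for k
    using that by (simp add: indiv_loss_def corrupt_def)
  show "\<bar>il \<theta> (corrupt gx gy D) i - il \<theta> (corrupt gx gy (D(i := z))) i\<bar> \<le> M"
    using loss_osc[OF \<theta> corrupt_component[OF D i] corrupt_component[OF space_PiM_fun_upd[OF D i z] i]]
    by (simp add: indiv_loss_def)
qed

section \<open>Bounded differences of the gap, the Rademacher averages and the corruption
  infimum\<close>

lemma bounded_differences_gap:
  "bounded_differences (\<lambda>_. P) {1..n} gap (\<lambda>_. real s / (real n * real q) * M)"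
  unfolding bounded_differences_def gap_def
proof (intro ballI cSUP_dist_le Theta_nonempty gap_bdd)
  fix i D z \<theta> assume "i \<in> {1..n}" "D \<in> space sample" "z \<in> space P" "\<theta> \<in> \<Theta>"
  then show "\<bar>risk \<theta> - top_q \<theta> (corrupt gx gy (D(i := z))) - (risk \<theta> - top_q \<theta> (corrupt gx gy D))\<bar>
      \<le> real s / (real n * real q) * M"
    using top_q_corrupt_diff[of \<theta> i D z] by linarith
qed (auto intro: space_PiM_fun_upd)

lemma bounded_differences_rad_sup:
  assumes \<xi>: "\<xi> \<in> signs"
  shows "bounded_differences (\<lambda>_. P) {1..n} (rad_sup \<xi>) (\<lambda>_. M / real n)"
  unfolding bounded_differences_def rad_sup_def
proof (intro ballI cSUP_dist_le Theta_nonempty rad_bdd \<xi>)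
  fix i D z \<theta> assume "i \<in> {1..n}" "D \<in> space sample" "z \<in> space P" "\<theta> \<in> \<Theta>"
  then show "\<bar>1 / real n * (\<Sum>k=1..n. \<xi> k * il \<theta> (D(i := z)) k) - 1 / real n * (\<Sum>k=1..n. \<xi> k * il \<theta> D k)\<bar>
      \<le> M / real n"
    using PiE_mem[OF \<xi>, of i] by (intro mean_signed_diff) auto
qed (auto intro: space_PiM_fun_upd)

lemma bounded_differences_emp_rad:
  "bounded_differences (\<lambda>_. P) {1..n} emp_rad (\<lambda>_. M / real n)"
  unfolding bounded_differences_def
proof (intro ballI)
  fix i D z assume A: "i \<in> {1..n}" "D \<in> space sample" "z \<in> space P"
  have "\<bar>\<Sum>\<xi>\<in>signs. rad_sup \<xi> (D(i := z)) - rad_sup \<xi> D\<bar> \<le> (\<Sum>\<xi>\<in>signs. M / real n)"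
    using bounded_differencesD[OF bounded_differences_rad_sup A]
    by (intro order.trans[OF sum_abs] sum_mono)
  also have "\<dots> = M / real n * 2 ^ n"
    by (simp add: card_signs del: One_nat_def)
  finally have "\<bar>\<Sum>\<xi>\<in>signs. rad_sup \<xi> (D(i := z)) - rad_sup \<xi> D\<bar> \<le> M / real n * 2 ^ n" .
  moreover have "emp_rad (D(i := z)) - emp_rad D = (\<Sum>\<xi>\<in>signs. rad_sup \<xi> (D(i := z)) - rad_sup \<xi> D) / 2 ^ n"
    by (simp add: emp_rad_def sum_subtractf diff_divide_distrib)
  ultimately show "\<bar>emp_rad (D(i := z)) - emp_rad D\<bar> \<le> M / real n"
    by (simp add: pos_divide_le_eq)
qed

lemma corruption_inf_eq:
  "corruption_inf loss f ord n s q \<Theta> gx gy D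
    = (INF \<theta>\<in>\<Theta>. top_q \<theta> (corrupt gx gy D) - (1 / real n) * (\<Sum>i=1..n. il \<theta> D i))"
  unfolding corruption_inf_def
  by (simp only: top_q_objective_eq_sample_weights[OF ord n_pos] sum_subtractf right_diff_distrib)

lemma corruption_bdd:
  assumes D: "D \<in> space sample"
  shows "bdd_below ((\<lambda>\<theta>. top_q \<theta> (corrupt gx gy D) - (1 / real n) * (\<Sum>i=1..n. il \<theta> D i)) ` \<Theta>)"
proof (rule bdd_belowI2)
  fix \<theta> assume \<theta>: "\<theta> \<in> \<Theta>"
  have "(\<lambda>i\<in>{1..n}. 1) \<in> signs" by auto
  from abs_le_D1[OF mean_signed_abs_le[OF this \<theta> D]]
  have "(1 / real n) * (\<Sum>i=1..n. il \<theta> D i) \<le> B" by simp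
  moreover have "0 \<le> top_q \<theta> (corrupt gx gy D)"
    by (rule top_q_nonneg[OF \<theta> corrupt_component[OF D]])
  ultimately show "- B \<le> top_q \<theta> (corrupt gx gy D) - (1 / real n) * (\<Sum>i=1..n. il \<theta> D i)"
    by linarith
qed

text \<open>Serves integrability, by which the mean of the gap and Q can be added under one
  integral; the infimum itself is never concentrated.\<close>

lemma bounded_differences_corruption_inf:
  "bounded_differences (\<lambda>_. P) {1..n} (corruption_inf loss f ord n s q \<Theta> gx gy)
    (\<lambda>_. real s / (real n * real q) * M + M / real n)"
  unfolding bounded_differences_def corruption_inf_eq
proof (intro ballI cINF_dist_le Theta_nonempty corruption_bdd)
  fix i D z \<theta> assume "i \<in> {1..n}" "D \<in> space sample" "z \<in> space P" "\<theta> \<in> \<Theta>"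
  then show "\<bar>top_q \<theta> (corrupt gx gy (D(i := z))) - 1 / real n * (\<Sum>k=1..n. il \<theta> (D(i := z)) k)
      - (top_q \<theta> (corrupt gx gy D) - 1 / real n * (\<Sum>k=1..n. il \<theta> D k))\<bar>
      \<le> real s / (real n * real q) * M + M / real n"
    using top_q_corrupt_diff[of \<theta> i D z] mean_signed_diff[of "\<lambda>_. 1" i \<theta> D z] by simp
qed (auto intro: space_PiM_fun_upd)

lemmas integrable_sample = integrable_bounded_differences[OF prob_space_axioms finite_atLeastAtMost]

text \<open>At each \<theta>, risk - L_q is (risk - empirical risk) - (L_q - empirical risk). The
  majorant \<open>G\<close> bounds the first bracket and \<open>corruption_inf\<close> the second,
  before the supremum is taken. Negating \<xi> only on \<open>{1..n}\<close> keeps the result in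
  \<open>signs\<close>.\<close>

lemma gap_expectation_le_signs:
  assumes \<xi>: "\<xi> \<in> signs"
  shows "integral\<^sup>L sample gap + Q_term loss f ord P n s q \<Theta> gx gy
    \<le> integral\<^sup>L sample (rad_sup \<xi>) + integral\<^sup>L sample (rad_sup (\<lambda>i\<in>{1..n}. - \<xi> i))"
proof -
  define \<xi>' where "\<xi>' = (\<lambda>i\<in>{1..n}. - \<xi> i)"
  have \<xi>': "\<xi>' \<in> signs" using \<xi> by (fastforce simp: \<xi>'_def PiE_iff)
  let ?h = "\<lambda>\<theta> z. loss (f (fst z) \<theta>) (snd z)"
  obtain G where G: "integrable sample G"
    "integral\<^sup>L sample G = integral\<^sup>L sample (rad_sup \<xi>) + integral\<^sup>L sample (rad_sup \<xi>')"
    "\<And>D \<theta>. D \<in> space sample \<Longrightarrow> \<theta> \<in> \<Theta> \<Longrightarrow>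
      integral\<^sup>L P (?h \<theta>) - 1 / real (card {1..n}) * (\<Sum>i\<in>{1..n}. ?h \<theta> (D i)) \<le> G D"
  proof (rule symmetrization_majorant[of P "{1..n}" \<Theta> ?h \<xi> "rad_sup \<xi>" "rad_sup \<xi>'" B])
    show "\<xi> i = - 1 \<or> \<xi> i = 1" if "i \<in> {1..n}" for i using PiE_mem[OF \<xi> that] by auto
    show "1 / real (card {1..n}) * (\<Sum>i\<in>{1..n}. \<xi> i * ?h \<theta> (D i)) \<le> rad_sup \<xi> D"
      if "D \<in> space sample" "\<theta> \<in> \<Theta>" for D \<theta>
      using cSUP_upper[OF that(2) rad_bdd[OF \<xi> that(1)]] by (simp add: rad_sup_def indiv_loss_def)
    show "1 / real (card {1..n}) * (\<Sum>i\<in>{1..n}. - \<xi> i * ?h \<theta> (D i)) \<le> rad_sup \<xi>' D"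
      if "D \<in> space sample" "\<theta> \<in> \<Theta>" for D \<theta>
      using cSUP_upper[OF that(2) rad_bdd[OF \<xi>' that(1)]] by (simp add: rad_sup_def indiv_loss_def \<xi>'_def)
  qed (use n_pos \<xi> \<xi>' integrable_loss rad_sup_meas rad_sup_abs_le prob_space_axioms in auto)
  let ?c = "corruption_inf loss f ord n s q \<Theta> gx gy"
  have le: "gap D + ?c D \<le> G D" if D: "D \<in> space sample" for D
  proof -
    have "gap D \<le> G D - ?c D"
      unfolding gap_def
    proof (rule cSUP_least[OF Theta_nonempty])
      fix \<theta> assume \<theta>: "\<theta> \<in> \<Theta>"
      have "?c D \<le> top_q \<theta> (corrupt gx gy D) - (1 / real n) * (\<Sum>i=1..n. il \<theta> D i)"
        unfolding corruption_inf_eq by (rule cINF_lower[OF corruption_bdd[OF D] \<theta>])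
      then show "risk \<theta> - top_q \<theta> (corrupt gx gy D) \<le> G D - ?c D"
        using G(3)[OF D \<theta>] by (simp add: population_risk_def indiv_loss_def)
    qed
    then show ?thesis by simp
  qed
  have int: "integrable sample gap" "integrable sample ?c"
    using integrable_sample bounded_differences_gap bounded_differences_corruption_inf
      gap_meas corruption_inf_meas by blast+
  have "integral\<^sup>L sample gap + integral\<^sup>L sample ?c = (\<integral>D. gap D + ?c D \<partial>sample)"
    using int by simp
  also have "\<dots> \<le> integral\<^sup>L sample G"
    using int G(1) le by (intro integral_mono) auto
  finally show ?thesis
    unfolding Q_term_def G(2) \<xi>'_def .
qed

text \<open>Averages over all sign vectors. Negation permutes \<open>signs\<close>, so both terms
  have the same average, whence the factor 2.\<close>

lemma gap_expectation_le:
  "integral\<^sup>L sample gap + Q_term loss f ord P n s q \<Theta> gx gy \<le> 2 * integral\<^sup>L sample emp_rad"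
proof -
  let ?neg = "\<lambda>\<xi>. \<lambda>i\<in>{1..n}. - \<xi> i :: real"
  let ?E = "integral\<^sup>L sample gap + Q_term loss f ord P n s q \<Theta> gx gy"
  let ?S = "\<Sum>\<xi>\<in>signs. integral\<^sup>L sample (rad_sup \<xi>)"
  have int: "integrable sample (rad_sup \<xi>)" if "\<xi> \<in> signs" for \<xi>
    using integrable_sample bounded_differences_rad_sup[OF that] rad_sup_meas[OF that] by blast
  have "2 ^ n * ?E = (\<Sum>\<xi>\<in>signs. ?E)"
    by (simp add: card_signs del: One_nat_def)
  also have "\<dots> \<le> (\<Sum>\<xi>\<in>signs. integral\<^sup>L sample (rad_sup \<xi>) + integral\<^sup>L sample (rad_sup (?neg \<xi>)))"
    by (intro sum_mono gap_expectation_le_signs)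
  also have "\<dots> = ?S + (\<Sum>\<xi>\<in>signs. integral\<^sup>L sample (rad_sup (?neg \<xi>)))"
    by (rule sum.distrib)
  also have "(\<Sum>\<xi>\<in>signs. integral\<^sup>L sample (rad_sup (?neg \<xi>))) = ?S"
    by (rule sum.reindex_bij_witness[of _ ?neg ?neg]) (fastforce simp: PiE_iff extensional_def)+
  also have "?S + ?S = 2 ^ n * (2 * integral\<^sup>L sample emp_rad)"
    unfolding emp_rad_def using int by simp
  finally show ?thesis by simp
qed

section \<open>The high-probability bound for bounded losses\<close>

theorem top_q_generalization_bound:
  assumes \<delta>: "0 < \<delta>" "\<delta> < 1"
  shows "measure sample
      {D \<in> space sample. \<forall>\<theta>\<in>\<Theta>.
         risk \<theta> \<le> top_q \<theta> (corrupt gx gy D) + 2 * emp_rad D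
           + M * (2 + real s / real q) * sqrt (ln (2 / \<delta>) / (2 * real n))
           - Q_term loss f ord P n s q \<Theta> gx gy}
    \<ge> 1 - \<delta>"
proof -
  interpret sample: prob_space sample by (intro prob_space_PiM prob_space_axioms)
  note [measurable] = gap_meas emp_rad_meas
  define t where "t = sqrt (ln (2 / \<delta>) / (2 * real n))"
  let ?Q = "Q_term loss f ord P n s q \<Theta> gx gy"
  \<comment> \<open>Written with \<open>gap\<close> and \<open>emp_rad\<close>, whose measurability
    is known; the quantifier over \<theta> returns only through a set equality at the end.\<close>
  let ?good = "{D \<in> space sample. gap D \<le> 2 * emp_rad D + M * (2 + real s / real q) * t - ?Q}"
  let ?bad1 = "{D \<in> space sample. gap D > integral\<^sup>L sample gap + M * (real s / real q) * t}"
  \<comment> \<open>The lower tail of \<open>emp_rad\<close>, since its mean has to be bounded by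
    its observed value; hence the negated function.\<close>
  let ?bad2 = "{D \<in> space sample. - emp_rad D > integral\<^sup>L sample (\<lambda>D. - emp_rad D) + M * t}"
  have I: "{1..n} \<noteq> {}" using n_pos by auto
  have "sample.prob ?bad1 \<le> \<delta> / 2"
    using mcdiarmid_confidence[OF prob_space_axioms finite_atLeastAtMost I gap_meas bounded_differences_gap,
        of "\<delta> / 2"] \<delta> M_nonneg n_pos
    by (simp add: t_def mult_ac)
  moreover have "sample.prob ?bad2 \<le> \<delta> / 2"
    using mcdiarmid_confidence[OF prob_space_axioms finite_atLeastAtMost I borel_measurable_uminus[OF emp_rad_meas]
        bounded_differences_minus[OF bounded_differences_emp_rad], of "\<delta> / 2"] \<delta> M_nonneg n_pos
    by (simp add: t_def)
  moreover have "1 - sample.prob ?good = sample.prob (space sample - ?good)"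
    by (rule sample.prob_compl[symmetric]) measurable
  moreover have "sample.prob (space sample - ?good) \<le> sample.prob (?bad1 \<union> ?bad2)"
  proof (rule sample.finite_measure_mono)
    show "space sample - ?good \<subseteq> ?bad1 \<union> ?bad2"
    proof
      fix D assume D: "D \<in> space sample - ?good"
      then have "gap D > 2 * emp_rad D + M * (2 + real s / real q) * t - ?Q"
        by (simp only: Diff_iff mem_Collect_eq) linarith
      also have "M * (2 + real s / real q) * t = M * (real s / real q) * t + 2 * (M * t)"
        by (simp only: distrib_left distrib_right mult_ac add_ac)
      finally have "gap D > 2 * emp_rad D + (M * (real s / real q) * t + 2 * (M * t)) - ?Q" .
      then have "gap D > integral\<^sup>L sample gap + M * (real s / real q) * t
          \<or> integral\<^sup>L sample emp_rad > emp_rad D + M * t"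
        using gap_expectation_le by linarith
      then show "D \<in> ?bad1 \<union> ?bad2" using D by auto
    qed
  qed measurable
  moreover have "sample.prob (?bad1 \<union> ?bad2) \<le> sample.prob ?bad1 + sample.prob ?bad2"
    by (intro measure_Un_le) measurable
  ultimately have "1 - \<delta> \<le> sample.prob ?good" by linarith
  moreover have "?good = {D \<in> space sample. \<forall>\<theta>\<in>\<Theta>.
         risk \<theta> \<le> top_q \<theta> (corrupt gx gy D) + 2 * emp_rad D + M * (2 + real s / real q) * t - ?Q}"
  proof (rule Collect_cong, rule conj_cong[OF refl])
    fix D assume D: "D \<in> space sample"
    show "gap D \<le> 2 * emp_rad D + M * (2 + real s / real q) * t - ?Q \<longleftrightarrow>
      (\<forall>\<theta>\<in>\<Theta>. risk \<theta> \<le> top_q \<theta> (corrupt gx gy D) + 2 * emp_rad D + M * (2 + real s / real q) * t - ?Q)"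
      unfolding gap_def cSUP_le_iff[OF Theta_nonempty gap_bdd[OF D]] by (auto simp: algebra_simps)
  qed
  ultimately show ?thesis by (simp add: t_def)
qed

end

section \<open>Reduction to bounded losses and confidence parameters below 1\<close>

theorem theorem1:
  fixes X :: "(real ^ 'dx) set" and Y :: "(real ^ 'dy) set"
    and P :: "((real ^ 'dx) \<times> (real ^ 'dy)) measure"
    and f :: "real ^ 'dx \<Rightarrow> real ^ 'dt \<Rightarrow> real ^ 'dy"
    and loss :: "real ^ 'dy \<Rightarrow> real ^ 'dy \<Rightarrow> real"
    and n s q :: nat
    and gx :: "nat \<Rightarrow> real ^ 'dx \<Rightarrow> real ^ 'dx"
    and gy :: "nat \<Rightarrow> real ^ 'dy \<Rightarrow> real ^ 'dy"
    and \<Theta> :: "(real ^ 'dt) set"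
    and ord :: "real ^ 'dt \<Rightarrow> (nat \<Rightarrow> (real ^ 'dx) \<times> (real ^ 'dy)) \<Rightarrow> nat \<Rightarrow> nat"
    and M \<delta> :: real
  assumes P: "prob_space P"
      "sets P = sets (restrict_space borel X \<Otimes>\<^sub>M restrict_space borel Y)"
    and f_meas: "\<And>\<theta>. \<theta> \<in> \<Theta> \<Longrightarrow> (\<lambda>x. f x \<theta>) \<in> borel_measurable borel"
    and loss_meas: "(\<lambda>(u, y). loss u y) \<in> borel_measurable (borel \<Otimes>\<^sub>M restrict_space borel Y)"
    and loss_nonneg: "\<And>u y. y \<in> Y \<Longrightarrow> loss u y \<ge> 0"
    and nsq: "1 \<le> q" "q \<le> s" "s \<le> n"
    and gx: "\<And>i. i \<in> {1..n} \<Longrightarrow> gx i \<in> restrict_space borel X \<rightarrow>\<^sub>M restrict_space borel X"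
    and gy: "\<And>i. i \<in> {1..n} \<Longrightarrow> gy i \<in> restrict_space borel Y \<rightarrow>\<^sub>M restrict_space borel Y"
    and Theta_nonempty: "\<Theta> \<noteq> {}"
    and M_finite: "bdd_above {\<bar>loss (f x \<theta>) y - loss (f x' \<theta>) y'\<bar> | \<theta> x y x' y'.
          \<theta> \<in> \<Theta> \<and> (x, y) \<in> X \<times> Y \<and> (x', y') \<in> X \<times> Y}"
    and M_eq: "M = Sup {\<bar>loss (f x \<theta>) y - loss (f x' \<theta>) y'\<bar> | \<theta> x y x' y'.
          \<theta> \<in> \<Theta> \<and> (x, y) \<in> X \<times> Y \<and> (x', y') \<in> X \<times> Y}"
    and ord: "ordered_indexes loss f n ord"
    and rademacher_sup_meas: "\<And>\<xi>. \<xi> \<in> {1..n} \<rightarrow>\<^sub>E {-1, 1} \<Longrightarrow>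
          (\<lambda>D. rademacher_sup loss f n \<Theta> D \<xi>) \<in> borel_measurable (\<Pi>\<^sub>M i\<in>{1..n}. P)"
    and corruption_inf_meas:
      "corruption_inf loss f ord n s q \<Theta> gx gy \<in> borel_measurable (\<Pi>\<^sub>M i\<in>{1..n}. P)"
    and gap_sup_meas:
      "(\<lambda>D. SUP \<theta>\<in>\<Theta>. population_risk loss f P \<theta>
            - top_q_objective loss f ord n s q \<theta> (corrupt gx gy D))
         \<in> borel_measurable (\<Pi>\<^sub>M i\<in>{1..n}. P)"
    and delta: "\<delta> > 0"
  shows "measure (\<Pi>\<^sub>M i\<in>{1..n}. P)
      {D \<in> space (\<Pi>\<^sub>M i\<in>{1..n}. P). \<forall>\<theta>\<in>\<Theta>.
         ereal (population_risk loss f P \<theta>)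
         \<le> ereal (top_q_objective loss f ord n s q \<theta> (corrupt gx gy D))
           + 2 * emp_rademacher loss f n \<Theta> D
           + ereal (M * (2 + real s / real q) * sqrt (ln (2 / \<delta>) / (2 * real n)))
           - ereal (Q_term loss f ord P n s q \<Theta> gx gy)}
    \<ge> 1 - \<delta>"
proof -
  interpret P: prob_space P by (rule P(1))
  let ?S = "PiM {1..n} (\<lambda>_. P)"
  interpret S: prob_space ?S by (intro prob_space_PiM P(1))
  have n: "n > 0" using nsq by simp
  have space_P: "space P = X \<times> Y"
    using sets_eq_imp_space_eq[OF P(2)] by (simp add: space_pair_measure space_restrict_space)
  have loss_P: "(\<lambda>z. loss (f (fst z) \<theta>) (snd z)) \<in> borel_measurable P" if "\<theta> \<in> \<Theta>" for \<theta>
  proof -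
    have [measurable]: "(\<lambda>x. f x \<theta>) \<in> restrict_space borel X \<rightarrow>\<^sub>M borel"
      using f_meas[OF that] by (rule measurable_restrict_space1)
    have "(\<lambda>z. (f (fst z) \<theta>, snd z))
        \<in> restrict_space borel X \<Otimes>\<^sub>M restrict_space borel Y \<rightarrow>\<^sub>M borel \<Otimes>\<^sub>M restrict_space borel Y"
      by measurable
    from measurable_comp[OF this loss_meas] show ?thesis
      by (simp add: o_def measurable_cong_sets[OF P(2) refl])
  qed
  have osc: "\<bar>loss (f (fst z) \<theta>) (snd z) - loss (f (fst z') \<theta>) (snd z')\<bar> \<le> M"
    if "\<theta> \<in> \<Theta>" "z \<in> space P" "z' \<in> space P" for \<theta> z z'
    unfolding M_eq using that by (intro cSup_upper[OF _ M_finite]) (force simp: space_P)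
  show ?thesis
  \<comment> \<open>A finite \<open>M\<close> does not bound the losses over
    \<open>\<Theta>\<close>: adding a constant that depends on \<theta> alone leaves every
    oscillation unchanged.\<close>
  proof (cases "\<exists>B. \<forall>\<theta>\<in>\<Theta>. \<forall>z\<in>space P. loss (f (fst z) \<theta>) (snd z) \<le> B")
    case False
    have "emp_rademacher loss f n \<Theta> D = \<infinity>" if D: "D \<in> space ?S" for D
    proof (rule emp_rademacher_infinite)
      show "rademacher_sup loss f n \<Theta> D (\<lambda>i\<in>{1..n}. 1) = \<infinity>"
        using False D osc by (intro rademacher_sup_unbounded[OF n, where S = "space P" and M = M])
          (auto simp: space_PiM not_le)
    qed auto
    then have "{D \<in> space ?S. \<forall>\<theta>\<in>\<Theta>.
         ereal (population_risk loss f P \<theta>)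
         \<le> ereal (top_q_objective loss f ord n s q \<theta> (corrupt gx gy D))
           + 2 * emp_rademacher loss f n \<Theta> D
           + ereal (M * (2 + real s / real q) * sqrt (ln (2 / \<delta>) / (2 * real n)))
           - ereal (Q_term loss f ord P n s q \<Theta> gx gy)} = space ?S"
      by auto
    then show ?thesis
      using delta S.prob_space by simp
  next
    case True
    then obtain B where B: "\<And>\<theta> z. \<theta> \<in> \<Theta> \<Longrightarrow> z \<in> space P \<Longrightarrow> loss (f (fst z) \<theta>) (snd z) \<le> B" by blast
    interpret bounded_loss_sample P f loss n s q gx gy \<Theta> ord M B
    proof
      fix i z assume i: "i \<in> {1..n}" and z: "z \<in> space P"
      show "(gx i (fst z), gy i (snd z)) \<in> space P"
        using measurable_space[OF gx[OF i], of "fst z"] measurable_space[OF gy[OF i], of "snd z"] z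
        by (auto simp: space_P space_restrict_space)
    qed (use loss_P loss_nonneg B osc nsq Theta_nonempty ord rademacher_sup_meas
        corruption_inf_meas gap_sup_meas in \<open>auto simp: space_P\<close>)
    show ?thesis
    proof (cases "\<delta> < 1")
      case True
      have "{D \<in> space ?S. \<forall>\<theta>\<in>\<Theta>.
         ereal (population_risk loss f P \<theta>)
         \<le> ereal (top_q_objective loss f ord n s q \<theta> (corrupt gx gy D))
           + 2 * emp_rademacher loss f n \<Theta> D
           + ereal (M * (2 + real s / real q) * sqrt (ln (2 / \<delta>) / (2 * real n)))
           - ereal (Q_term loss f ord P n s q \<Theta> gx gy)}
        = {D \<in> space ?S. \<forall>\<theta>\<in>\<Theta>.
         population_risk loss f P \<theta> \<le> top_q_objective loss f ord n s q \<theta> (corrupt gx gy D)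
           + 2 * emp_rad D
           + M * (2 + real s / real q) * sqrt (ln (2 / \<delta>) / (2 * real n))
           - Q_term loss f ord P n s q \<Theta> gx gy}"
        \<comment> \<open>With the coefficient 2 written as \<open>ereal 2\<close>, every term is a
          finite extended real and the inequality is one between reals.\<close>
        unfolding numeral_eq_ereal
        by (intro Collect_cong conj_cong refl)
          (simp only: emp_rademacher_eq times_ereal.simps plus_ereal.simps ereal_minus(1) ereal_less_eq)
      then show ?thesis
        using top_q_generalization_bound[OF delta True] by simp
    next
      case False
      \<comment> \<open>Here \<open>1 - \<delta>\<close> is at most 0, so the sign of ln (2 /
        \<delta>), negative for \<delta> > 2, is irrelevant.\<close>
      then show ?thesis by (intro order.trans[OF _ measure_nonneg]) simp
    qed
  qed
qed

end
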